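(* Consider the Cauchy problem $$u_{tt}-\Delta u+b(t)u_t-g(t)\Delta u_t=0,\quad (t,x)\in[0,\infty)\times\mathbb{R}^n,\qquad u(0,x)=u_0(x),\quad u_t(0,x)=u_1(x),\quad x\in\mathbb{R}^n,$$ with $b(t)=e^{e^t}$ and $g(t)=2e^{-t}$. Then Sobolev solutions satisfy $$\||D|^{|\beta|}u(t,\cdot)\|_{L^2}\lesssim\|u_0\|_{\dot H^{|\beta|}}+\|u_1\|_{\dot H^{|\beta|-2}}\quad\text{for }|\beta|\ge2,$$ $$\||D|^{|\beta|}u_t(t,\cdot)\|_{L^2}\lesssim b(t)\big(\|u_0\|_{\dot H^{|\beta|}}+\|u_1\|_{\dot H^{|\beta|-2}}\big)+g(t)\big(\|u_0\|_{\dot H^{|\beta|+2}}+\|u_1\|_{\dot H^{|\beta|}}\big)\quad\text{for }|\beta|\ge2.$$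
   Context: $f\lesssim h$ means $f\le Ch$ with a constant $C>0$ independent of $t$ and of the data. $|D|^a$ is the Fourier multiplier with symbol $|\xi|^a$; $\dot H^a=\dot H^a(\mathbb{R}^n)$ is the Riesz potential space based on $L^2$ with norm $\||\xi|^a\hat f\|_{L^2}$. $|\beta|$ denotes the order of differentiation (a number). Each estimate is understood for data for which its right-hand side is finite. Sobolev solutions are understood via the partial Fourier transform in $x$: $\hat u(t,\xi)$ solves $\hat u_{tt}+|\xi|^2\hat u+(b(t)+g(t)|\xi|^2)\hat u_t=0$, $\hat u(0,\xi)=\hat u_0(\xi)$, $\hat u_t(0,\xi)=\hat u_1(\xi)$. *)

theory Defs
  imports "HOL-Analysis.Analysis"
begin

text \<open>
  The homogeneous spaces of order at least n/2 do not consist of tempered distributions but of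
  tempered distributions modulo polynomials. They are realised, as usual, inside the dual Z' of the
  space Z of Schwartz functions all of whose moments vanish, i.e. of the Fourier transforms of
  Schwartz functions that are flat at the origin. A functional is a map on all
  complex-valued functions, but only its values on Z matter.
\<close>

type_synonym 'n zfunctional = "(real ^ 'n \<Rightarrow> complex) \<Rightarrow> complex"

subsection \<open>Test functions\<close>

primrec partials :: "'n list \<Rightarrow> (real ^ 'n::finite \<Rightarrow> complex) \<Rightarrow> real ^ 'n \<Rightarrow> complex" where
  "partials [] f = f"
| "partials (i # is) f = (\<lambda>x. frechet_derivative (partials is f) (at x) (axis i 1))"

definition schwartz :: "(real ^ 'n::finite \<Rightarrow> complex) set" where
  "schwartz = {f. (\<forall>is x. partials is f differentiable (at x)) \<and>
                  (\<forall>is (k::nat). \<exists>M. \<forall>x. (1 + norm x) ^ k * norm (partials is f x) \<le> M)}"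

definition fourier :: "(real ^ 'n::finite \<Rightarrow> complex) \<Rightarrow> real ^ 'n \<Rightarrow> complex" where
  "fourier f \<xi> = complex_of_real ((2 * pi) powr (- real CARD('n) / 2)) *
                 (LINT x|lborel. exp (- \<i> * complex_of_real (x \<bullet> \<xi>)) * f x)"

definition flat_schwartz :: "(real ^ 'n::finite \<Rightarrow> complex) set" where
  "flat_schwartz = {f \<in> schwartz. \<forall>is. partials is f 0 = 0}"

definition Z_space :: "(real ^ 'n::finite \<Rightarrow> complex) set" where
  "Z_space = fourier ` flat_schwartz"

text \<open>Continuity is boundedness by one of the Schwartz seminorms.\<close>

definition Z_dual :: "'n::finite zfunctional set" where
  "Z_dual = {T.
     (\<forall>\<phi>\<in>Z_space. \<forall>\<psi>\<in>Z_space. T (\<lambda>x. \<phi> x + \<psi> x) = T \<phi> + T \<psi>) \<and>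
     (\<forall>c. \<forall>\<phi>\<in>Z_space. T (\<lambda>x. c * \<phi> x) = c * T \<phi>) \<and>
     (\<exists>(N::nat) C. \<forall>\<phi>\<in>Z_space. \<forall>M.
        (\<forall>is x. length is \<le> N \<longrightarrow> (1 + norm x) ^ N * norm (partials is \<phi> x) \<le> M)
          \<longrightarrow> norm (T \<phi>) \<le> C * M)}"

subsection \<open>Fourier transform on Z' and norms\<close>

text \<open>
  \<open>has_fourier T F\<close>: the Fourier transform of T, defined by duality, is (integration against)
  the function F. Such an F is unique up to null sets, which justifies \<open>fourier_fn\<close>.
\<close>

definition has_fourier :: "'n::finite zfunctional \<Rightarrow> (real ^ 'n \<Rightarrow> complex) \<Rightarrow> bool" where
  "has_fourier T F \<longleftrightarrow> F \<in> borel_measurable borel \<and>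
     (\<forall>\<phi>\<in>flat_schwartz. integrable lborel (\<lambda>\<xi>. F \<xi> * \<phi> \<xi>) \<and>
        T (fourier \<phi>) = (LINT \<xi>|lborel. F \<xi> * \<phi> \<xi>))"

definition fourier_fn :: "'n::finite zfunctional \<Rightarrow> real ^ 'n \<Rightarrow> complex" where
  "fourier_fn T = (SOME F. has_fourier T F)"

definition L2_norm :: "(real ^ 'n::finite \<Rightarrow> complex) \<Rightarrow> ennreal" where
  "L2_norm f = (let I = (\<integral>\<^sup>+ x. ennreal ((norm (f x))\<^sup>2) \<partial>lborel)
                in if I = top then top else ennreal (sqrt (enn2real I)))"

definition L2_fun :: "(real ^ 'n::finite \<Rightarrow> complex) set" where
  "L2_fun = {f \<in> borel_measurable borel. L2_norm f < top}"

definition hdot_norm :: "real \<Rightarrow> 'n::finite zfunctional \<Rightarrow> ennreal" where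
  "hdot_norm a T =
     (if \<exists>F. has_fourier T F
      then L2_norm (\<lambda>\<xi>. complex_of_real (norm \<xi> powr a) * fourier_fn T \<xi>) else top)"

definition functional_of :: "(real ^ 'n::finite \<Rightarrow> complex) \<Rightarrow> 'n zfunctional" where
  "functional_of h = (\<lambda>\<psi>. LINT x|lborel. h x * \<psi> x)"

text \<open>
  \<open>is_frac_deriv a T h\<close>: the square integrable function h (of the space variable x) is \<open>|D|\<^sup>a T\<close>.
\<close>

definition is_frac_deriv :: "real \<Rightarrow> 'n::finite zfunctional \<Rightarrow> (real ^ 'n \<Rightarrow> complex) \<Rightarrow> bool" where
  "is_frac_deriv a T h \<longleftrightarrow> h \<in> L2_fun \<and>
     (\<exists>F. has_fourier T F \<and>
          has_fourier (functional_of h) (\<lambda>\<xi>. complex_of_real (norm \<xi> powr a) * F \<xi>))"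

text \<open>
  The \<open>L\<^sup>2\<close> norm of \<open>|D|\<^sup>a T\<close>, which is infinite if \<open>|D|\<^sup>a T\<close> is not a square integrable function;
  otherwise that function is unique up to null sets, so that the infimum is just its norm.
\<close>

definition L2_norm_D :: "real \<Rightarrow> 'n::finite zfunctional \<Rightarrow> ennreal" where
  "L2_norm_D a T = (INF h\<in>{h. is_frac_deriv a T h}. L2_norm h)"

subsection \<open>Sobolev solutions\<close>

text \<open>The derivative with respect to t in the weak-* sense, i.e. tested against elements of Z.\<close>

definition time_deriv :: "(real \<Rightarrow> 'n::finite zfunctional) \<Rightarrow> real \<Rightarrow> 'n zfunctional" where
  "time_deriv u t = (\<lambda>\<psi>. vector_derivative (\<lambda>s. u s \<psi>) (at t within {0..}))"

text \<open>
  The functions U, V, W are the partial Fourier transform of u and its first two time derivatives.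
  The Fourier transforms of the data are determined up to null sets only, hence the equation
  is required for almost every frequency.
\<close>

definition sobolev_solution ::
  "(real \<Rightarrow> real) \<Rightarrow> (real \<Rightarrow> real) \<Rightarrow> 'n::finite zfunctional \<Rightarrow> 'n zfunctional \<Rightarrow>
   (real \<Rightarrow> 'n zfunctional) \<Rightarrow> bool" where
  "sobolev_solution b g u0 u1 u \<longleftrightarrow>
     u0 \<in> Z_dual \<and> u1 \<in> Z_dual \<and> (\<forall>t\<ge>0. u t \<in> Z_dual) \<and>
     (\<exists>F. has_fourier u0 F) \<and> (\<exists>F. has_fourier u1 F) \<and>
     (\<exists>U V W :: real \<Rightarrow> real ^ 'n \<Rightarrow> complex.
        (\<forall>t\<ge>0. has_fourier (u t) (U t)) \<and>
        (AE \<xi> in lborel. \<forall>t\<ge>0.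
           ((\<lambda>s. U s \<xi>) has_vector_derivative V t \<xi>) (at t within {0..}) \<and>
           ((\<lambda>s. V s \<xi>) has_vector_derivative W t \<xi>) (at t within {0..}) \<and>
           W t \<xi> + complex_of_real ((norm \<xi>)\<^sup>2) * U t \<xi>
             + complex_of_real (b t + g t * (norm \<xi>)\<^sup>2) * V t \<xi> = 0) \<and>
        (AE \<xi> in lborel. U 0 \<xi> = fourier_fn u0 \<xi>) \<and>
        (AE \<xi> in lborel. V 0 \<xi> = fourier_fn u1 \<xi>))"

end

theory Submission
  imports Defs "HOL-Probability.Sinc_Integral" "HOL-Probability.Characteristic_Functions"
begin

text \<open>
  Each frequency \<open>\<xi>\<close> carries a damped oscillator \<open>y'' + p y' + r\<^sup>2 y = 0\<close> with \<open>r = norm \<xi>\<close> and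
  \<open>p t = b t + g t * r\<^sup>2\<close>. The product of the two damping terms is at least \<open>2 e r\<^sup>2\<close>, so that every
  mode is overdamped at every time, uniformly in \<open>r\<close>, and strongly enough that the cone
  \<open>- (p/2) y \<le> y' \<le> 0\<close> of the phase plane is invariant although \<open>p\<close> may decrease. The norm whose unit
  ball is spanned by the edges \<open>(1, 0)\<close> and \<open>(1, - p/2)\<close> of the cone is therefore nonincreasing along
  solutions. It controls \<open>y\<close> and \<open>y' / p\<close>, and initially it is at most
  \<open>norm (y 0) + 4 / p 0 * norm (y' 0)\<close>, where \<open>p 0 \<ge> 2 r\<^sup>2\<close>. This proves (\<open>damped_mode_bound\<close>), for all
  \<open>r > 0\<close> and without a distinction between low and high frequencies,
  \<open>norm (y t) \<le> M\<close> and \<open>norm (y' t) \<le> p t * M\<close> with \<open>M = norm (y 0) + 2 / r\<^sup>2 * norm (y' 0)\<close>.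
  Multiplied by \<open>r powr \<beta>\<close> and integrated, these are the two claims on the Fourier side.

  The quantity to be estimated is the norm of a function of \<open>x\<close> that represents \<open>|D|\<^sup>\<beta> u\<close>, and this
  function has to be produced from its Fourier transform. Hence the second ingredient is that every
  square integrable \<open>G\<close> is the Fourier transform, in the sense of duality with flat Schwartz functions,
  of some \<open>h\<close> with norm at most that of \<open>G\<close> (\<open>inverse_fourier_exists\<close>). Plancherel's inequality and
  Parseval's identity are obtained from the formula \<open>\<integral> f * fourier g = \<integral> fourier f * g\<close> and Gaussian
  cutoffs; the inverse transform of \<open>G\<close> is the limit of those of its truncations to balls.

  Finally, \<open>time_deriv u t\<close> is a weak derivative. By the bounds for a single mode, which hold uniformly on
  bounded time intervals, dominated convergence identifies its Fourier transform with the time derivative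
  of that of \<open>u\<close> (\<open>has_fourier_time_deriv\<close>).
\<close>

section \<open>Overdamped oscillators\<close>

lemma smoothed_norm_has_derivative:
  fixes f :: "real \<Rightarrow> 'a::real_inner"
  assumes "(f has_vector_derivative f') (at t within S)" "\<epsilon> > 0"
  shows "((\<lambda>s. sqrt (f s \<bullet> f s + \<epsilon>\<^sup>2)) has_real_derivative (f t \<bullet> f') / sqrt (f t \<bullet> f t + \<epsilon>\<^sup>2)) (at t within S)"
proof -
  have pos: "f t \<bullet> f t + \<epsilon>\<^sup>2 > 0"
    using assms(2) by (simp add: add_nonneg_pos)
  have "((\<lambda>s. f s \<bullet> f s) has_vector_derivative (f t \<bullet> f' + f' \<bullet> f t)) (at t within S)"
    by (rule bounded_bilinear.has_vector_derivative[OF bounded_bilinear_inner assms(1) assms(1)])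
  then have "((\<lambda>s. f s \<bullet> f s + \<epsilon>\<^sup>2) has_real_derivative 2 * (f t \<bullet> f')) (at t within S)"
    by (auto intro!: derivative_eq_intros simp: has_real_derivative_iff_has_vector_derivative inner_commute)
  from DERIV_chain2[OF DERIV_real_sqrt[OF pos] this] show ?thesis
    by (simp add: field_simps)
qed

lemma smoothed_norm_between:
  fixes x :: "'a::real_inner"
  assumes "\<epsilon> > 0"
  shows "norm x \<le> sqrt (x \<bullet> x + \<epsilon>\<^sup>2)" "sqrt (x \<bullet> x + \<epsilon>\<^sup>2) \<le> norm x + \<epsilon>"
  using assms by (auto simp: norm_eq_sqrt_inner[of x] intro!: real_le_lsqrt)
    (simp add: power2_sum)

text \<open>
  These are the derivatives of the smoothed norm in the directions \<open>x\<close> and \<open>y\<close>: it decays along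
  \<open>- x\<close> at the rate \<open>norm x\<close> up to the error \<open>\<epsilon>\<close>, and it has Lipschitz constant 1.
\<close>

lemma smoothed_norm_bounds:
  fixes x y :: "'a::real_inner"
  assumes "\<epsilon> > 0"
  shows "norm x - \<epsilon> \<le> (x \<bullet> x) / sqrt (x \<bullet> x + \<epsilon>\<^sup>2)"
    and "(x \<bullet> y) / sqrt (x \<bullet> x + \<epsilon>\<^sup>2) \<le> norm y"
proof -
  let ?s = "sqrt (x \<bullet> x + \<epsilon>\<^sup>2)"
  have s: "?s > 0" "norm x \<le> ?s" "?s \<le> norm x + \<epsilon>"
    using assms smoothed_norm_between[of \<epsilon> x] by (auto simp: add_nonneg_pos)
  have "(norm x - \<epsilon>) * ?s \<le> norm x * norm x"
  proof (cases "norm x \<ge> \<epsilon>")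
    case True
    then have "(norm x - \<epsilon>) * ?s \<le> (norm x - \<epsilon>) * (norm x + \<epsilon>)"
      using s by (intro mult_left_mono) auto
    also have "\<dots> \<le> norm x * norm x"
      by (simp add: algebra_simps)
    finally show ?thesis .
  next
    case False
    then have "(norm x - \<epsilon>) * ?s \<le> 0"
      using s by (intro mult_nonpos_nonneg) auto
    then show ?thesis
      by (meson order_trans zero_le_square)
  qed
  then show "norm x - \<epsilon> \<le> (x \<bullet> x) / ?s"
    using s by (simp add: pos_le_divide_eq power2_norm_eq_inner[symmetric] power2_eq_square)
  have "x \<bullet> y \<le> norm x * norm y"
    by (rule norm_cauchy_schwarz)
  also have "\<dots> \<le> norm y * ?s"
    using mult_left_mono[OF s(2) norm_ge_zero[of y]] by (simp add: mult.commute)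
  finally show "(x \<bullet> y) / ?s \<le> norm y"
    using s by (simp add: field_simps)
qed

text \<open>
  This is a compartment model: \<open>\<alpha>\<close> hands mass to \<open>\<beta>\<close> at rate \<open>a\<close>, \<open>\<beta>\<close> hands mass to \<open>\<alpha>\<close> at rate
  \<open>m\<close> and loses mass at rate \<open>\<kappa>\<close>, so that the total mass \<open>norm \<alpha> + norm \<beta>\<close> cannot grow. The norm is
  not differentiable at 0; it is replaced by \<open>sqrt (norm x\<^sup>2 + \<epsilon>\<^sup>2)\<close>, which costs at most
  \<open>\<epsilon> * (a + m)\<close> in the derivative and disappears as \<open>\<epsilon>\<close> tends to 0; the bound
  \<open>B\<close> on the rates makes this error uniform in time.
\<close>

lemma exchange_system_norm_nonincreasing:
  fixes \<alpha> \<beta> :: "real \<Rightarrow> 'a::real_inner" and a m \<kappa> :: "real \<Rightarrow> real"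
  assumes T: "T \<ge> 0"
    and \<alpha>: "\<And>t. t \<in> {0..T} \<Longrightarrow> (\<alpha> has_vector_derivative (m t *\<^sub>R \<beta> t - a t *\<^sub>R \<alpha> t)) (at t within {0..T})"
    and \<beta>: "\<And>t. t \<in> {0..T} \<Longrightarrow>
      (\<beta> has_vector_derivative (a t *\<^sub>R \<alpha> t - (m t + \<kappa> t) *\<^sub>R \<beta> t)) (at t within {0..T})"
    and a: "\<And>t. t \<in> {0..T} \<Longrightarrow> 0 \<le> a t \<and> a t \<le> B"
    and m: "\<And>t. t \<in> {0..T} \<Longrightarrow> 0 \<le> m t \<and> m t \<le> B"
    and \<kappa>: "\<And>t. t \<in> {0..T} \<Longrightarrow> 0 \<le> \<kappa> t"
  shows "norm (\<alpha> T) + norm (\<beta> T) \<le> norm (\<alpha> 0) + norm (\<beta> 0)"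
proof -
  have approx: "norm (\<alpha> T) + norm (\<beta> T) \<le> norm (\<alpha> 0) + norm (\<beta> 0) + \<epsilon> * (2 + 2 * B * T)" if \<epsilon>: "\<epsilon> > 0" for \<epsilon>
  proof -
    define S where "S x = sqrt (x \<bullet> x + \<epsilon>\<^sup>2)" for x :: 'a
    have S: "norm x \<le> S x" "S x \<le> norm x + \<epsilon>" for x
      unfolding S_def by (rule smoothed_norm_between[OF \<epsilon>])+
    define f where "f t = S (\<alpha> t) + S (\<beta> t) - 2 * B * \<epsilon> * t" for t
    define f' where "f' t = (\<alpha> t \<bullet> (m t *\<^sub>R \<beta> t - a t *\<^sub>R \<alpha> t)) / S (\<alpha> t) +
        (\<beta> t \<bullet> (a t *\<^sub>R \<alpha> t - (m t + \<kappa> t) *\<^sub>R \<beta> t)) / S (\<beta> t) - 2 * B * \<epsilon>" for t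
    have der: "(f has_real_derivative f' t) (at t within {0..T})" if "t \<in> {0..T}" for t
    proof -
      have "((\<lambda>t. 2 * B * \<epsilon> * t) has_real_derivative 2 * B * \<epsilon>) (at t within {0..T})"
        by (auto intro!: derivative_eq_intros)
      then show ?thesis
        unfolding f_def f'_def S_def
        using smoothed_norm_has_derivative[OF \<alpha>[OF that] \<epsilon>] smoothed_norm_has_derivative[OF \<beta>[OF that] \<epsilon>]
        by (intro DERIV_diff DERIV_add)
    qed
    have nonpos: "f' t \<le> 0" if t: "t \<in> {0..T}" for t
    proof -
      let ?A = "\<alpha> t" and ?B = "\<beta> t"
      have b: "norm x - \<epsilon> \<le> (x \<bullet> x) / S x" "(x \<bullet> z) / S x \<le> norm z" for x z
        unfolding S_def by (rule smoothed_norm_bounds[OF \<epsilon>])+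
      have "f' t = m t * ((?A \<bullet> ?B) / S ?A) - a t * ((?A \<bullet> ?A) / S ?A)
         + a t * ((?B \<bullet> ?A) / S ?B) - (m t + \<kappa> t) * ((?B \<bullet> ?B) / S ?B) - 2 * B * \<epsilon>"
        by (simp add: f'_def inner_diff_right diff_divide_distrib)
      also have "\<dots> \<le> m t * norm ?B - a t * (norm ?A - \<epsilon>) + a t * norm ?A - m t * (norm ?B - \<epsilon>) - 2 * B * \<epsilon>"
      proof -
        have "0 \<le> (?B \<bullet> ?B) / S ?B"
          by (simp add: S_def add_nonneg_nonneg)
        then have "\<kappa> t * ((?B \<bullet> ?B) / S ?B) \<ge> 0"
          using \<kappa>[OF t] by (rule mult_nonneg_nonneg[rotated])
        moreover have "m t * ((?A \<bullet> ?B) / S ?A) \<le> m t * norm ?B" "a t * (norm ?A - \<epsilon>) \<le> a t * ((?A \<bullet> ?A) / S ?A)"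
          "a t * ((?B \<bullet> ?A) / S ?B) \<le> a t * norm ?A" "m t * (norm ?B - \<epsilon>) \<le> m t * ((?B \<bullet> ?B) / S ?B)"
          by (auto simp only: intro!: mult_left_mono b a[OF t, THEN conjunct1] m[OF t, THEN conjunct1])
        ultimately show ?thesis
          unfolding distrib_right by linarith
      qed
      also have "\<dots> = (a t + m t - 2 * B) * \<epsilon>"
        by (simp add: algebra_simps)
      also have "\<dots> \<le> 0"
        using a[OF t] m[OF t] \<epsilon> by (intro mult_nonpos_nonneg) auto
      finally show ?thesis .
    qed
    have "f T \<le> f 0"
    proof (rule DERIV_nonpos_imp_decreasing_open[OF T])
      show "continuous_on {0..T} f"
        using der by (meson DERIV_continuous_on)
      show "\<exists>y. (f has_real_derivative y) (at t) \<and> y \<le> 0" if "0 < t" "t < T" for t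
        using der[of t] nonpos[of t] that by (auto simp: at_within_Icc_at)
    qed
    then show ?thesis
      using S[of "\<alpha> T"] S[of "\<beta> T"] S[of "\<alpha> 0"] S[of "\<beta> 0"]
      by (simp add: f_def algebra_simps)
  qed
  show ?thesis
  proof (rule tendsto_lowerbound)
    show "((\<lambda>\<epsilon>. norm (\<alpha> 0) + norm (\<beta> 0) + \<epsilon> * (2 + 2 * B * T)) \<longlongrightarrow> norm (\<alpha> 0) + norm (\<beta> 0)) (at_right 0)"
      by (auto intro!: tendsto_eq_intros)
    show "\<forall>\<^sub>F \<epsilon> in at_right 0. norm (\<alpha> T) + norm (\<beta> T) \<le> norm (\<alpha> 0) + norm (\<beta> 0) + \<epsilon> * (2 + 2 * B * T)"
      by (auto simp: eventually_at_right_less intro!: eventually_mono[OF eventually_at_right_less] approx)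
  qed auto
qed

text \<open>
  For \<open>y'' + p y' + r\<^sup>2 y = 0\<close> consider the cone \<open>0 \<le> y\<close>, \<open>- (p/2) y \<le> y' \<le> 0\<close> in the phase plane. By
  the Riccati equation for \<open>y' / y\<close>, the condition \<open>damp\<close> says exactly that solutions do not leave the
  cone through the edge \<open>y' = - (p/2) y\<close>. The edges are spanned by \<open>(1, 0)\<close> and \<open>(1, - p/2)\<close>; in the
  coordinates \<open>\<alpha>\<close>, \<open>\<beta>\<close> with respect to these vectors, invariance of the cone means nonnegative
  exchange rates, so that \<open>norm \<alpha> + norm \<beta>\<close> is nonincreasing even for vector-valued \<open>y\<close>. The position
  is \<open>\<alpha> + \<beta>\<close> and the velocity is \<open>- (p/2) \<beta>\<close>, which gives both bounds. The point of taking the cone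
  as wide as \<open>p/2\<close> is the small factor \<open>4 / p 0\<close> in front of the initial velocity.
\<close>

lemma overdamped_oscillator_bound:
  fixes y v :: "real \<Rightarrow> 'a::real_inner" and p p' :: "real \<Rightarrow> real"
  assumes T: "T \<ge> 0"
    and y: "\<And>t. t \<in> {0..T} \<Longrightarrow> (y has_vector_derivative v t) (at t within {0..T})"
    and v: "\<And>t. t \<in> {0..T} \<Longrightarrow>
      (v has_vector_derivative (- (r\<^sup>2 *\<^sub>R y t) - p t *\<^sub>R v t)) (at t within {0..T})"
    and p: "\<And>t. t \<in> {0..T} \<Longrightarrow> (p has_real_derivative p' t) (at t within {0..T})"
    and p': "continuous_on {0..T} p'"
    and pos: "\<And>t. t \<in> {0..T} \<Longrightarrow> p t > 0"
    and damp: "\<And>t. t \<in> {0..T} \<Longrightarrow> 4 * r\<^sup>2 \<le> (p t)\<^sup>2 + 2 * p' t"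
  shows "norm (y T) \<le> norm (y 0) + 4 / p 0 * norm (v 0)"
    and "norm (v T) \<le> p T / 2 * (norm (y 0) + 4 / p 0 * norm (v 0))"
proof -
  \<comment> \<open>coordinates with respect to the edges \<open>(1, 0)\<close> and \<open>(1, - p/2)\<close> of the cone\<close>
  define \<beta> where "\<beta> t = (- 2 / p t) *\<^sub>R v t" for t
  define \<alpha> where "\<alpha> t = y t - \<beta> t" for t
  define a where "a t = 2 * r\<^sup>2 / p t" for t
  define m where "m t = p t / 2 - a t + p' t / p t" for t
  have v_eq: "v t = - (p t / 2) *\<^sub>R \<beta> t" if "t \<in> {0..T}" for t
    using pos[OF that] by (simp add: \<beta>_def)
  have y_eq: "y t = \<alpha> t + \<beta> t" for t
    by (simp add: \<alpha>_def)
  have d\<beta>: "(\<beta> has_vector_derivative (a t *\<^sub>R \<alpha> t - (m t + p t / 2) *\<^sub>R \<beta> t)) (at t within {0..T})"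
    if t: "t \<in> {0..T}" for t
  proof -
    have "((\<lambda>t. - 2 / p t) has_real_derivative 2 * p' t / (p t)\<^sup>2) (at t within {0..T})"
      using p[OF t] pos[OF t] by (auto intro!: derivative_eq_intros simp: power2_eq_square)
    then have "(\<beta> has_vector_derivative (- 2 / p t) *\<^sub>R (- (r\<^sup>2 *\<^sub>R y t) - p t *\<^sub>R v t) + (2 * p' t / (p t)\<^sup>2) *\<^sub>R v t)
        (at t within {0..T})"
      unfolding \<beta>_def using v[OF t] by (intro has_vector_derivative_scaleR)
    also have "(- 2 / p t) *\<^sub>R (- (r\<^sup>2 *\<^sub>R y t) - p t *\<^sub>R v t) + (2 * p' t / (p t)\<^sup>2) *\<^sub>R v t
       = a t *\<^sub>R \<alpha> t + (a t - p t - p' t / p t) *\<^sub>R \<beta> t"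
      using pos[OF t] by (simp add: v_eq[OF t] y_eq a_def scaleR_diff_right algebra_simps power2_eq_square
          scaleR_add_left[symmetric] del: scaleR_add_left)
    also have "a t - p t - p' t / p t = - (m t + p t / 2)"
      by (simp add: m_def)
    finally show ?thesis
      by (simp only: scaleR_minus_left add_uminus_conv_diff)
  qed
  have d\<alpha>: "(\<alpha> has_vector_derivative (m t *\<^sub>R \<beta> t - a t *\<^sub>R \<alpha> t)) (at t within {0..T})" if t: "t \<in> {0..T}" for t
  proof -
    have "(\<alpha> has_vector_derivative (v t - (a t *\<^sub>R \<alpha> t - (m t + p t / 2) *\<^sub>R \<beta> t))) (at t within {0..T})"
      unfolding \<alpha>_def by (intro has_vector_derivative_diff y d\<beta>[unfolded \<alpha>_def] t)
    then show ?thesis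
      by (simp add: v_eq[OF t] algebra_simps)
  qed
  \<comment> \<open>the rates are bounded on \<open>{0..T}\<close> by compactness\<close>
  have "continuous_on {0..T} p"
    using p by (meson DERIV_continuous_on)
  then have "continuous_on {0..T} (\<lambda>t. a t + m t)"
    unfolding a_def m_def using p' pos by (intro continuous_intros) force+
  then obtain B where B: "\<And>t. t \<in> {0..T} \<Longrightarrow> a t + m t \<le> B"
    using compact_continuous_image[OF _ compact_Icc, THEN compact_imp_bounded, THEN bounded_imp_bdd_above]
    by (force simp: bdd_above_def)
  have a0: "a t \<ge> 0" if "t \<in> {0..T}" for t
    using pos[OF that] by (simp add: a_def)
  have m0: "m t \<ge> 0" if t: "t \<in> {0..T}" for t
  proof -
    have "m t = ((p t)\<^sup>2 + 2 * p' t - 4 * r\<^sup>2) / (2 * p t)"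
      using pos[OF t] by (simp add: m_def a_def field_simps power2_eq_square)
    then show ?thesis
      using damp[OF t] pos[OF t] by simp
  qed
  have "norm (\<alpha> T) + norm (\<beta> T) \<le> norm (\<alpha> 0) + norm (\<beta> 0)"
  proof (rule exchange_system_norm_nonincreasing[where B = B, OF T d\<alpha> d\<beta>])
    fix t assume t: "t \<in> {0..T}"
    show "0 \<le> a t \<and> a t \<le> B" "0 \<le> m t \<and> m t \<le> B" "0 \<le> p t / 2"
      using a0[OF t] m0[OF t] B[OF t] pos[OF t] by auto
  qed auto
  also have "\<dots> \<le> norm (y 0) + 2 * norm (\<beta> 0)"
    using norm_triangle_ineq4[of "y 0" "\<beta> 0"] by (simp add: \<alpha>_def)
  also have "2 * norm (\<beta> 0) = 4 / p 0 * norm (v 0)"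
    using pos[of 0] T by (simp add: \<beta>_def)
  finally have N: "norm (\<alpha> T) + norm (\<beta> T) \<le> norm (y 0) + 4 / p 0 * norm (v 0)" .
  then show "norm (y T) \<le> norm (y 0) + 4 / p 0 * norm (v 0)"
    using norm_triangle_ineq[of "\<alpha> T" "\<beta> T"] by (simp add: y_eq)
  have "norm (v T) = p T / 2 * norm (\<beta> T)"
    using pos[of T] T by (subst v_eq) auto
  also have "\<dots> \<le> p T / 2 * (norm (y 0) + 4 / p 0 * norm (v 0))"
    using N pos[of T] T norm_ge_zero[of "\<alpha> T"] by (intro mult_left_mono) (linarith, auto)
  finally show "norm (v T) \<le> p T / 2 * (norm (y 0) + 4 / p 0 * norm (v 0))" .
qed

text \<open>
  The two parts of the damping have the product \<open>2 exp (exp t - t) r\<^sup>2 \<ge> 2 e r\<^sup>2\<close>, since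
  \<open>exp t - t \<ge> 1\<close>. Therefore \<open>p\<^sup>2\<close> exceeds \<open>4 r\<^sup>2\<close> with room to
  spare, and the decreasing part of \<open>p'\<close> is absorbed by \<open>p\<^sup>2\<close>, because \<open>exp (exp t) \<ge> e\<close>.
\<close>

lemma damping_dominates:
  fixes r t :: real
  defines "p \<equiv> exp (exp t) + 2 * exp (- t) * r\<^sup>2"
  assumes "t \<ge> 0"
  shows "4 * r\<^sup>2 \<le> p\<^sup>2 + 2 * (exp t * exp (exp t) - 2 * exp (- t) * r\<^sup>2)"
proof -
  let ?b = "exp (exp t)" and ?c = "2 * exp (- t) * r\<^sup>2"
  have e: "exp (1::real) \<ge> 5 / 2"
    using exp_lower_Taylor_quadratic[of "1::real"] by simp
  have "exp t - t \<ge> 1"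
    using exp_ge_add_one_self[of t] by linarith
  then have "exp (exp t - t) \<ge> 5 / 2"
    using e by (meson exp_le_cancel_iff order_trans)
  then have "2 * r\<^sup>2 * exp (exp t - t) \<ge> 2 * r\<^sup>2 * (5 / 2)"
    by (intro mult_left_mono) auto
  then have "?b * ?c \<ge> 5 * r\<^sup>2"
    by (simp add: exp_diff exp_minus field_simps)
  moreover have "?b \<ge> 5 / 2"
    using assms(2) e by (smt (verit) exp_le_cancel_iff one_le_exp_iff)
  then have "?b * ?b \<ge> 5/2 * (5/2)"
    by (intro mult_mono) auto
  moreover have "exp t * ?b \<ge> 0"
    by simp
  \<comment> \<open>complete the square in the decreasing part \<open>c\<close>; \<open>b * b\<close> pays for the remaining \<open>- 1\<close>\<close>
  moreover have "4 * r\<^sup>2 \<le> (b + c)\<^sup>2 + 2 * (d - c)"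
    if "b * c \<ge> 5 * r\<^sup>2" "b * b \<ge> 5/2 * (5/2)" "d \<ge> 0" for b c d
  proof -
    have "(b + c)\<^sup>2 + 2 * (d - c) = b * b + 2 * (b * c) + (c - 1)\<^sup>2 - 1 + 2 * d"
      by (simp add: power2_eq_square algebra_simps)
    then show ?thesis
      using that zero_le_power2[of "c - 1"] zero_le_power2[of r] by linarith
  qed
  ultimately show ?thesis
    unfolding p_def by blast
qed

text \<open>
  At \<open>t = 0\<close> the damping \<open>exp 1 + 2 r\<^sup>2\<close> is at least \<open>2 r\<^sup>2\<close>. This is where the gain of two derivatives
  in the initial velocity comes from, at low and high frequencies alike.
\<close>

lemma damped_mode_bound:
  fixes y v w :: "real \<Rightarrow> complex" and r T :: real
  assumes T: "T \<ge> 0" and r: "r > 0"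
    and ode: "\<And>t. t \<ge> 0 \<Longrightarrow> (y has_vector_derivative v t) (at t within {0..}) \<and>
       (v has_vector_derivative w t) (at t within {0..}) \<and>
       w t + complex_of_real (r\<^sup>2) * y t
         + complex_of_real (exp (exp t) + 2 * exp (- t) * r\<^sup>2) * v t = 0"
  shows "norm (y T) \<le> norm (y 0) + 2 / r\<^sup>2 * norm (v 0)"
    and "norm (v T) \<le> (exp (exp T) + 2 * exp (- T) * r\<^sup>2) * (norm (y 0) + 2 / r\<^sup>2 * norm (v 0))"
proof -
  define p where "p t = exp (exp t) + 2 * exp (- t) * r\<^sup>2" for t
  have pos: "p t > 0" for t
    by (simp add: p_def add_pos_nonneg)
  have w: "w t = - (r\<^sup>2 *\<^sub>R y t) - p t *\<^sub>R v t" if "t \<ge> 0" for t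
    using ode[OF that] unfolding p_def scaleR_conv_of_real by (simp add: eq_neg_iff_add_eq_0 algebra_simps)
  have *: "norm (y T) \<le> norm (y 0) + 4 / p 0 * norm (v 0)"
    "norm (v T) \<le> p T / 2 * (norm (y 0) + 4 / p 0 * norm (v 0))"
  proof (atomize(full), intro conjI)
    note o = overdamped_oscillator_bound[OF T, of y v r p "\<lambda>t. exp t * exp (exp t) - 2 * exp (- t) * r\<^sup>2"]
    have prems: "(y has_vector_derivative v t) (at t within {0..T})"
      "(v has_vector_derivative (- (r\<^sup>2 *\<^sub>R y t) - p t *\<^sub>R v t)) (at t within {0..T})"
      "(p has_real_derivative (exp t * exp (exp t) - 2 * exp (- t) * r\<^sup>2)) (at t within {0..T})"
      "4 * r\<^sup>2 \<le> (p t)\<^sup>2 + 2 * (exp t * exp (exp t) - 2 * exp (- t) * r\<^sup>2)"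
      if t: "t \<in> {0..T}" for t
      using ode[of t] t w[of t] damping_dominates[of t r] unfolding p_def
      by (auto intro: has_vector_derivative_within_subset intro!: derivative_eq_intros)
    have cont: "continuous_on {0..T} (\<lambda>t. exp t * exp (exp t) - 2 * exp (- t) * r\<^sup>2)"
      by (intro continuous_intros)
    show "norm (y T) \<le> norm (y 0) + 4 / p 0 * norm (v 0)"
      using o(1)[OF prems(1,2,3) cont pos prems(4)] by blast
    show "norm (v T) \<le> p T / 2 * (norm (y 0) + 4 / p 0 * norm (v 0))"
      using o(2)[OF prems(1,2,3) cont pos prems(4)] by blast
  qed
  have "4 / p 0 \<le> 4 / (2 * r\<^sup>2)"
    using r by (intro divide_left_mono) (auto simp: p_def add_pos_nonneg)
  then have le: "4 / p 0 * norm (v 0) \<le> 2 / r\<^sup>2 * norm (v 0)"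
    by (intro mult_right_mono) auto
  show "norm (y T) \<le> norm (y 0) + 2 / r\<^sup>2 * norm (v 0)"
    using *(1) le by linarith
  note *(2)
  also have "p T / 2 * (norm (y 0) + 4 / p 0 * norm (v 0)) \<le> p T * (norm (y 0) + 2 / r\<^sup>2 * norm (v 0))"
    using le pos[of T] pos[of 0] by (intro mult_mono) auto
  finally show "norm (v T) \<le> (exp (exp T) + 2 * exp (- T) * r\<^sup>2) * (norm (y 0) + 2 / r\<^sup>2 * norm (v 0))"
    unfolding p_def .
qed

section \<open>Decay and flatness of the test functions\<close>

lemma
  fixes f :: "'a::euclidean_space \<Rightarrow> real \<Rightarrow> 'b::{real_normed_field,banach,second_countable_topology}"
  assumes f: "\<And>b. b \<in> Basis \<Longrightarrow> integrable lborel (f b)"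
  shows integrable_lborel_prod_Basis: "integrable lborel (\<lambda>x::'a. \<Prod>b\<in>Basis. f b (x \<bullet> b))"
    and integral_lborel_prod_Basis: "(LINT x|lborel. (\<Prod>b\<in>Basis. f b ((x::'a) \<bullet> b))) = (\<Prod>b\<in>Basis. (LINT t|lborel. f b t))"
proof -
  interpret product_sigma_finite "\<lambda>_::'a. lborel :: real measure" ..
  let ?s = "\<lambda>g. \<Sum>b\<in>Basis. g b *\<^sub>R b :: 'a"
  have [measurable]: "f b \<in> borel_measurable borel" if "b \<in> Basis" for b
    using f[OF that] by simp
  have s: "(\<Prod>b\<in>Basis. f b (?s g \<bullet> b)) = (\<Prod>b\<in>Basis. f b (g b))" for g
    by (intro prod.cong) auto
  have [measurable]: "?s \<in> borel_measurable (Pi\<^sub>M Basis (\<lambda>_. lborel))"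
    by measurable
  have m: "(\<lambda>x::'a. \<Prod>b\<in>Basis. f b (x \<bullet> b)) \<in> borel_measurable borel"
    by measurable
  show "integrable lborel (\<lambda>x::'a. \<Prod>b\<in>Basis. f b (x \<bullet> b))"
    using product_integrable_prod[OF finite_Basis f]
    by (subst lborel_eq, subst integrable_distr_eq[OF _ m]) (simp_all add: s)
  show "(LINT x|lborel. (\<Prod>b\<in>Basis. f b ((x::'a) \<bullet> b))) = (\<Prod>b\<in>Basis. (LINT t|lborel. f b t))"
    using product_integral_prod[OF finite_Basis f]
    by (subst lborel_eq, subst integral_distr[OF _ m]) (simp_all add: s)
qed

text \<open>
  The factor for the coordinate \<open>b\<close> in \<open>(1 + norm x) ^ (2 * DIM('a))\<close> is at least \<open>1 + (x \<bullet> b)\<^sup>2\<close>,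
  so that the arctangent density in one variable suffices.
\<close>

lemma integrable_inverse_power:
  "integrable lborel (\<lambda>x::'a::euclidean_space. 1 / (1 + norm x) ^ (2 * DIM('a)))"
proof (rule Bochner_Integration.integrable_bound)
  have "integrable lborel (\<lambda>t::real. 1 / (1 + t\<^sup>2))"
    using integrable_inverse_1_plus_square by (simp add: set_integrable_def inverse_eq_divide)
  then show "integrable lborel (\<lambda>x::'a. \<Prod>b\<in>Basis. 1 / (1 + (x \<bullet> b)\<^sup>2))"
    by (rule integrable_lborel_prod_Basis)
  show "AE x in lborel. norm (1 / (1 + norm x) ^ (2 * DIM('a))) \<le> norm (\<Prod>b\<in>Basis. 1 / (1 + ((x::'a) \<bullet> b)\<^sup>2))"
  proof (rule AE_I2)
    fix x :: 'a
    have [simp]: "1 + norm x \<noteq> 0"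
      by (simp add: add_nonneg_eq_0_iff)
    have "(\<Prod>b\<in>(Basis::'a set). 1 / (1 + norm x)\<^sup>2) \<le> (\<Prod>b\<in>Basis. 1 / (1 + (x \<bullet> b)\<^sup>2))"
    proof (rule prod_mono, intro conjI divide_left_mono mult_pos_pos)
      fix b :: 'a assume b: "b \<in> Basis"
      have "(x \<bullet> b)\<^sup>2 \<le> (norm x)\<^sup>2"
        using Basis_le_norm[OF b, of x] by (simp add: abs_le_square_iff[symmetric])
      then show "1 + (x \<bullet> b)\<^sup>2 \<le> (1 + norm x)\<^sup>2"
        by (simp add: power2_sum add_increasing2)
    qed (auto simp: add_pos_nonneg)
    moreover have "(\<Prod>b\<in>(Basis::'a set). 1 / (1 + norm x)\<^sup>2) = 1 / (1 + norm x) ^ (2 * DIM('a))"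
      by (simp add: power_mult power_divide)
    ultimately show "norm (1 / (1 + norm x) ^ (2 * DIM('a))) \<le> norm (\<Prod>b\<in>Basis. 1 / (1 + (x \<bullet> b)\<^sup>2))"
      by (simp add: prod_nonneg)
  qed
qed measurable

text \<open>
  Vanishing to order \<open>k\<close> at the origin is proved for all partial derivatives at once: if every first
  derivative of a function is \<open>O(norm x ^ k)\<close>, the mean value inequality on the segment from 0 to \<open>x\<close>
  makes the function itself \<open>O(norm x ^ Suc k)\<close>.
\<close>

lemma
  fixes \<phi> :: "real ^ 'n::finite \<Rightarrow> complex"
  assumes "\<phi> \<in> flat_schwartz"
  shows flat_schwartz_decay: "\<exists>C. \<forall>x. norm (\<phi> x) \<le> C / (1 + norm x) ^ k"
    and flat_schwartz_vanishing: "\<exists>C. \<forall>x. norm (\<phi> x) \<le> C * norm x ^ k"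
    and flat_schwartz_measurable: "\<phi> \<in> borel_measurable borel"
    and flat_schwartz_continuous: "isCont \<phi> x"
proof -
  have diff: "partials is \<phi> differentiable (at x)" for "is" x
    using assms by (simp add: flat_schwartz_def schwartz_def)
  have bdd: "\<exists>M. \<forall>x. (1 + norm x) ^ k * norm (partials is \<phi> x) \<le> M" for "is" and k :: nat
    using assms by (simp add: flat_schwartz_def schwartz_def)
  have flat: "partials is \<phi> 0 = 0" for "is"
    using assms by (simp add: flat_schwartz_def)
  show cont: "isCont \<phi> x" for x
    using diff[of "[]" x] by (simp add: differentiable_imp_continuous_within)
  show "\<phi> \<in> borel_measurable borel"
    using cont by (intro borel_measurable_continuous_onI) (simp add: continuous_on_eq_continuous_within)
  show "\<exists>C. \<forall>x. norm (\<phi> x) \<le> C / (1 + norm x) ^ k"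
    using bdd[of k "[]"] by (simp add: pos_le_divide_eq add_pos_nonneg mult.commute)
  have "\<exists>C\<ge>0. \<forall>x. norm (partials is \<phi> x) \<le> C * norm x ^ k" for "is"
  proof (induction k arbitrary: "is")
    case 0
    obtain M where "\<forall>x. norm (partials is \<phi> x) \<le> M"
      using bdd[of 0 "is"] by auto
    moreover from this have "M \<ge> 0"
      by (meson norm_ge_zero order_trans)
    ultimately show ?case
      by auto
  next
    case (Suc k)
    let ?f = "partials is \<phi>"
    have "\<forall>i. \<exists>C\<ge>0. \<forall>x. norm (partials (i # is) \<phi> x) \<le> C * norm x ^ k"
      using Suc by blast
    then obtain C where C: "\<And>i. C i \<ge> 0" "\<And>i x. norm (partials (i # is) \<phi> x) \<le> C i * norm x ^ k"
      by metis
    have "norm (?f x) \<le> sum C UNIV * norm x ^ Suc k" for x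
    proof -
      have "norm (?f x - ?f 0) \<le> sum C UNIV * norm x ^ k * norm (x - 0)"
      proof (rule differentiable_bound[where S = "closed_segment 0 x"])
        fix z assume z: "z \<in> closed_segment 0 x"
        let ?D = "frechet_derivative ?f (at z)"
        have D: "(?f has_derivative ?D) (at z)"
          using diff[of "is" z] by (simp add: frechet_derivative_works)
        then show "(?f has_derivative ?D) (at z within closed_segment 0 x)"
          by (rule has_derivative_at_withinI)
        interpret D: bounded_linear ?D
          using D by (rule has_derivative_bounded_linear)
        have nz: "norm z \<le> norm x"
          using z by (auto simp: in_segment mult_left_le_one_le)
        show "onorm ?D \<le> sum C UNIV * norm x ^ k"
        proof (rule onorm_bound)
          show "0 \<le> sum C UNIV * norm x ^ k"
            using C by (simp add: sum_nonneg)
          fix h :: "real ^ 'n"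
          have "h = (\<Sum>i\<in>UNIV. (h $ i) *\<^sub>R axis i 1)"
            using basis_expansion[of h] by (simp add: scalar_mult_eq_scaleR)
          then have "?D h = (\<Sum>i\<in>UNIV. (h $ i) *\<^sub>R ?D (axis i 1))"
            by (metis (no_types, lifting) D.sum D.scaleR sum.cong)
          also have "norm \<dots> \<le> (\<Sum>i\<in>UNIV. norm h * (C i * norm x ^ k))"
          proof (rule sum_norm_le)
            fix i :: 'n
            have "norm (?D (axis i 1)) \<le> C i * norm z ^ k"
              using C(2)[of i z] by simp
            also have "\<dots> \<le> C i * norm x ^ k"
              using nz C(1)[of i] by (simp add: mult_left_mono power_mono)
            finally have "norm (?D (axis i 1)) \<le> C i * norm x ^ k" .
            then show "norm ((h $ i) *\<^sub>R ?D (axis i 1)) \<le> norm h * (C i * norm x ^ k)"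
              using component_le_norm_cart[of h i] by (auto intro!: mult_mono)
          qed
          also have "\<dots> = sum C UNIV * norm x ^ k * norm h"
            by (simp add: sum_distrib_left sum_distrib_right mult_ac)
          finally show "norm (?D h) \<le> sum C UNIV * norm x ^ k * norm h" .
        qed
      qed auto
      then show ?thesis
        by (simp add: flat mult_ac)
    qed
    then show ?case
      using C(1) by (intro exI[of _ "sum C UNIV"]) (auto simp: sum_nonneg)
  qed
  from this[of "[]"] show "\<exists>C. \<forall>x. norm (\<phi> x) \<le> C * norm x ^ k"
    by auto
qed

lemma flat_schwartz_integrable:
  fixes \<phi> :: "real ^ 'n::finite \<Rightarrow> complex"
  assumes \<phi>: "\<phi> \<in> flat_schwartz"
  shows "integrable lborel \<phi>"
proof -
  obtain C where C: "\<And>x. norm (\<phi> x) \<le> C / (1 + norm x) ^ (2 * DIM(real ^ 'n))"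
    using flat_schwartz_decay[OF \<phi>] by blast
  show ?thesis
  proof (rule Bochner_Integration.integrable_bound)
    show "integrable lborel (\<lambda>x::real^'n. C * (1 / (1 + norm x) ^ (2 * DIM(real ^ 'n))))"
      by (rule integrable_mult_right[OF integrable_inverse_power])
    show "AE x in lborel. norm (\<phi> x) \<le> norm (C * (1 / (1 + norm x) ^ (2 * DIM(real ^ 'n))))"
    proof (rule AE_I2)
      fix x
      show "norm (\<phi> x) \<le> norm (C * (1 / (1 + norm x) ^ (2 * DIM(real ^ 'n))))"
        unfolding real_norm_def by (rule order_trans[OF _ abs_ge_self]) (use C[of x] in simp)
    qed
  qed (use flat_schwartz_measurable[OF \<phi>] in simp)
qed

text \<open>
  Flatness at the origin pays for the singularity of \<open>norm x powr (- a)\<close>, and rapid decay pays for the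
  growth of this weight if \<open>a < 0\<close>. This makes \<open>\<integral> F \<phi>\<close> converge as soon as \<open>norm x powr a * F\<close> is
  square integrable, for every real \<open>a\<close>.
\<close>

lemma flat_schwartz_weighted_square_integrable:
  fixes \<phi> :: "real ^ 'n::finite \<Rightarrow> complex"
  assumes \<phi>: "\<phi> \<in> flat_schwartz"
  shows "integrable lborel (\<lambda>x. (norm x powr (- a) * norm (\<phi> x))\<^sup>2)"
proof -
  define m where "m = nat \<lceil>\<bar>a\<bar>\<rceil>"
  let ?N = "DIM(real ^ 'n)"
  have am: "\<bar>a\<bar> \<le> real m"
    by (simp add: m_def real_nat_ceiling_ge)
  obtain C1 where C1: "\<And>x. norm (\<phi> x) \<le> C1 * norm x ^ m"
    using flat_schwartz_vanishing[OF \<phi>] by blast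
  obtain C2 where C2: "\<And>x. norm (\<phi> x) \<le> C2 / (1 + norm x) ^ (m + ?N)"
    using flat_schwartz_decay[OF \<phi>] by blast
  define K where "K = max (\<bar>C1\<bar> * 2 ^ ?N) \<bar>C2\<bar>"
  have K: "norm x powr (- a) * norm (\<phi> x) \<le> K / (1 + norm x) ^ ?N" for x :: "real ^ 'n"
  proof (cases "x = 0")
    case True
    then show ?thesis by (simp add: K_def)
  next
    case False
    then have x: "norm x > 0" by simp
    show ?thesis
    proof (cases "norm x \<le> 1")
      case True
      have "norm x powr (- a) * norm (\<phi> x) \<le> norm x powr (- real m) * (\<bar>C1\<bar> * norm x ^ m)"
      proof (intro mult_mono)
        show "norm x powr (- a) \<le> norm x powr (- real m)"
          using am True x by (intro powr_mono') auto
        show "norm (\<phi> x) \<le> \<bar>C1\<bar> * norm x ^ m"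
          by (rule order_trans[OF C1]) (intro mult_right_mono, auto)
      qed auto
      also have "\<dots> = \<bar>C1\<bar>"
        using x by (simp add: powr_minus powr_realpow)
      also have "\<dots> \<le> K / (1 + norm x) ^ ?N"
      proof -
        have "\<bar>C1\<bar> * (1 + norm x) ^ ?N \<le> \<bar>C1\<bar> * 2 ^ ?N"
          using True by (intro mult_left_mono power_mono) auto
        also have "\<dots> \<le> K"
          by (simp add: K_def)
        finally show ?thesis
          using x by (simp add: pos_le_divide_eq add_pos_pos)
      qed
      finally show ?thesis .
    next
      case False
      have "norm x powr (- a) \<le> norm x powr real m"
        using am False by (intro powr_mono) auto
      also have "\<dots> \<le> (1 + norm x) ^ m"
        using x by (simp add: powr_realpow power_mono)
      finally have "norm x powr (- a) * norm (\<phi> x) \<le> (1 + norm x) ^ m * (\<bar>C2\<bar> / (1 + norm x) ^ (m + ?N))"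
        by (intro mult_mono order_trans[OF C2] divide_right_mono) auto
      also have "\<dots> = \<bar>C2\<bar> / (1 + norm x) ^ ?N"
        using x by (simp add: power_add)
      also have "\<dots> \<le> K / (1 + norm x) ^ ?N"
        by (intro divide_right_mono) (auto simp: K_def)
      finally show ?thesis .
    qed
  qed
  show ?thesis
  proof (rule Bochner_Integration.integrable_bound)
    show "integrable lborel (\<lambda>x::real^'n. K\<^sup>2 * (1 / (1 + norm x) ^ (2 * ?N)))"
      by (rule integrable_mult_right[OF integrable_inverse_power])
    have "(norm x powr (- a) * norm (\<phi> x))\<^sup>2 \<le> K\<^sup>2 * (1 / (1 + norm x) ^ (2 * ?N))" for x :: "real ^ 'n"
      using power_mono[OF K[of x], of 2]
      by (simp add: power_divide power_mult[symmetric] mult.commute)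
    then show "AE x in lborel. norm ((norm x powr (- a) * norm (\<phi> x))\<^sup>2) \<le> norm (K\<^sup>2 * (1 / (1 + norm x) ^ (2 * ?N)))"
      by (auto intro!: AE_I2)
    show "(\<lambda>x. (norm x powr (- a) * norm (\<phi> x))\<^sup>2) \<in> borel_measurable lborel"
      using flat_schwartz_measurable[OF \<phi>] by measurable
  qed
qed

section \<open>Fourier integrals and Gaussians\<close>

text \<open>
  The factor in front of the Fourier integral; it also normalises the standard Gaussian.
\<close>

definition normaliser :: "'n::finite itself \<Rightarrow> real" where
  "normaliser _ = (2 * pi) powr (- real CARD('n) / 2)"

lemma integral_lborel_affine:
  fixes f :: "'a::euclidean_space \<Rightarrow> 'b::{banach,second_countable_topology}"
  assumes [measurable]: "f \<in> borel_measurable borel" and c: "c \<noteq> 0"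
  shows "(LINT x|lborel. f x) = \<bar>c\<bar> ^ DIM('a) *\<^sub>R (LINT x|lborel. f (t + c *\<^sub>R x))"
proof -
  have "(LINT x|lborel. f x) = (LINT x|density (distr lborel borel (\<lambda>x. t + c *\<^sub>R x)) (\<lambda>_. ennreal (\<bar>c\<bar> ^ DIM('a))). f x)"
    using lborel_affine[OF c, of t] by (simp add: ennreal_power)
  also have "\<dots> = (LINT x|distr lborel borel (\<lambda>x. t + c *\<^sub>R x). \<bar>c\<bar> ^ DIM('a) *\<^sub>R f x)"
    by (subst integral_density) auto
  also have "\<dots> = (LINT x|lborel. \<bar>c\<bar> ^ DIM('a) *\<^sub>R f (t + c *\<^sub>R x))"
    by (subst integral_distr) auto
  finally show ?thesis
    by simp
qed

lemma nn_integral_lborel_affine: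
  fixes f :: "'a::euclidean_space \<Rightarrow> ennreal"
  assumes [measurable]: "f \<in> borel_measurable borel" and c: "c \<noteq> 0"
  shows "(\<integral>\<^sup>+x. f x \<partial>lborel) = ennreal (\<bar>c\<bar> ^ DIM('a)) * (\<integral>\<^sup>+x. f (t + c *\<^sub>R x) \<partial>lborel)"
proof -
  have "(\<integral>\<^sup>+x. f x \<partial>lborel) = (\<integral>\<^sup>+x. f x \<partial>density (distr lborel borel (\<lambda>x. t + c *\<^sub>R x)) (\<lambda>_. ennreal (\<bar>c\<bar> ^ DIM('a))))"
    using lborel_affine[OF c, of t] by (simp add: ennreal_power)
  also have "\<dots> = ennreal (\<bar>c\<bar> ^ DIM('a)) * (\<integral>\<^sup>+x. f (t + c *\<^sub>R x) \<partial>lborel)"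
    by (simp add: nn_integral_density nn_integral_distr nn_integral_cmult)
  finally show ?thesis .
qed

lemma integrable_lborel_affine:
  fixes f :: "'a::euclidean_space \<Rightarrow> 'b::{banach,second_countable_topology}"
  assumes f: "integrable lborel f" and c: "c \<noteq> 0"
  shows "integrable lborel (\<lambda>x. f (t + c *\<^sub>R x))"
proof -
  have [measurable]: "f \<in> borel_measurable borel"
    using f by simp
  have "(\<integral>\<^sup>+x. ennreal (norm (f x)) \<partial>lborel) < \<infinity>"
    using f by (simp add: integrable_iff_bounded)
  moreover have "\<bar>c\<bar> ^ DIM('a) > 0"
    using c by simp
  ultimately have "(\<integral>\<^sup>+x. ennreal (norm (f (t + c *\<^sub>R x))) \<partial>lborel) < \<infinity>"
    by (subst (asm) nn_integral_lborel_affine[OF _ c, of _ t]) (auto simp: ennreal_mult_less_top)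
  then show ?thesis
    by (simp add: integrable_iff_bounded)
qed

lemma norm_fourier_kernel: "norm (exp (- \<i> * complex_of_real s)) = 1"
  by (simp add: norm_exp_eq_Re)

lemma fourier_measurable [measurable]:
  fixes f :: "real ^ 'n::finite \<Rightarrow> complex"
  assumes [measurable]: "f \<in> borel_measurable borel"
  shows "fourier f \<in> borel_measurable borel"
  unfolding fourier_def by measurable

lemma fourier_bounded:
  fixes f :: "real ^ 'n::finite \<Rightarrow> complex"
  shows "norm (fourier f \<xi>) \<le> normaliser TYPE('n) * (LINT x|lborel. norm (f x))"
proof -
  have "norm (LINT x|lborel. exp (- \<i> * complex_of_real (x \<bullet> \<xi>)) * f x) \<le>
      (LINT x|lborel. norm (exp (- \<i> * complex_of_real (x \<bullet> \<xi>)) * f x))"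
    by (rule integral_norm_bound)
  also have "\<dots> = (LINT x|lborel. norm (f x))"
    by (simp only: norm_mult norm_fourier_kernel mult_1)
  finally show ?thesis
    unfolding fourier_def normaliser_def by (simp add: norm_mult mult_left_mono)
qed

lemma integrable_fourier_kernel:
  fixes f :: "real ^ 'n::finite \<Rightarrow> complex"
  assumes "integrable lborel f"
  shows "integrable lborel (\<lambda>x. exp (- \<i> * complex_of_real (x \<bullet> \<xi>)) * f x)"
proof (rule Bochner_Integration.integrable_bound[OF assms])
  show "AE x in lborel. norm (exp (- \<i> * complex_of_real (x \<bullet> \<xi>)) * f x) \<le> norm (f x)"
    by (simp only: norm_mult norm_fourier_kernel) simp
qed (use assms in measurable)

lemma fourier_diff:
  fixes f g :: "real ^ 'n::finite \<Rightarrow> complex"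
  assumes "integrable lborel f" "integrable lborel g"
  shows "fourier (\<lambda>x. f x - g x) \<xi> = fourier f \<xi> - fourier g \<xi>"
  unfolding fourier_def using integrable_fourier_kernel[OF assms(1)] integrable_fourier_kernel[OF assms(2)]
  by (simp add: right_diff_distrib)

lemma fourier_cnj:
  fixes f :: "real ^ 'n::finite \<Rightarrow> complex"
  shows "fourier (\<lambda>x. cnj (f x)) \<xi> = cnj (fourier f (- \<xi>))"
proof -
  have "cnj (LINT x|lborel. exp (- \<i> * complex_of_real (x \<bullet> (- \<xi>))) * f x)
    = (LINT x|lborel. cnj (exp (- \<i> * complex_of_real (x \<bullet> (- \<xi>))) * f x))"
    by (simp only: Bochner_Integration.integral_cnj)
  also have "\<dots> = (LINT x|lborel. exp (- \<i> * complex_of_real (x \<bullet> \<xi>)) * cnj (f x))"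
    by (simp add: exp_cnj)
  finally show ?thesis
    by (simp add: fourier_def)
qed

lemma fourier_reflect:
  fixes f :: "real ^ 'n::finite \<Rightarrow> complex"
  assumes [measurable]: "f \<in> borel_measurable borel"
  shows "fourier (\<lambda>x. f (- x)) \<xi> = fourier f (- \<xi>)"
  unfolding fourier_def
  by (subst integral_lborel_affine[where c = "-1" and t = 0]) auto

text \<open>
  Both sides are the integral of \<open>f x * exp (- \<i> x \<bullet> y) * g y\<close> over both variables.
\<close>

lemma fourier_multiplication:
  fixes f g :: "real ^ 'n::finite \<Rightarrow> complex"
  assumes f: "integrable lborel f" and g: "integrable lborel g"
  shows "(LINT x|lborel. f x * fourier g x) = (LINT x|lborel. fourier f x * g x)"
proof -
  have [measurable]: "f \<in> borel_measurable borel" "g \<in> borel_measurable borel"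
    using f g by simp_all
  define k where "k x y = exp (- \<i> * complex_of_real (x \<bullet> y))" for x y :: "real ^ 'n"
  have [measurable]: "(\<lambda>(x, y). k x y) \<in> borel_measurable (lborel \<Otimes>\<^sub>M lborel)"
    unfolding k_def by measurable
  have nk: "norm (k x y) = 1" for x y
    unfolding k_def by (rule norm_fourier_kernel)
  have int: "integrable (lborel \<Otimes>\<^sub>M lborel) (\<lambda>(x, y). f x * k x y * g y)"
  proof (rule lborel_pair.Fubini_integrable)
    show "integrable lborel (\<lambda>x. LINT y|lborel. norm (case (x, y) of (x, y) \<Rightarrow> f x * k x y * g y))"
      using f by (simp add: norm_mult nk)
    show "AE x in lborel. integrable lborel (\<lambda>y. case (x, y) of (x, y) \<Rightarrow> f x * k x y * g y)"
    proof (rule AE_I2)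
      fix x
      have "integrable lborel (\<lambda>y. k x y * g y)"
        using integrable_fourier_kernel[OF g, of x] by (simp add: k_def inner_commute)
      then show "integrable lborel (\<lambda>y. case (x, y) of (x, y) \<Rightarrow> f x * k x y * g y)"
        by (simp add: mult.assoc)
    qed
  qed measurable
  have K1: "f x * fourier g x = normaliser TYPE('n) * (LINT y|lborel. f x * k x y * g y)" for x
    by (simp add: fourier_def normaliser_def k_def inner_commute[of x] mult.assoc mult.left_commute)
  have K2: "fourier f y * g y = normaliser TYPE('n) * (LINT x|lborel. f x * k x y * g y)" for y
    unfolding mult.commute[of "f _"] integral_mult_left_zero
    by (simp add: fourier_def normaliser_def k_def mult.assoc)
  show ?thesis
    unfolding K1 K2 integral_mult_right_zero lborel_pair.Fubini_integral[OF int] ..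
qed

definition gaussian :: "real ^ 'n::finite \<Rightarrow> real" where
  "gaussian x = exp (- (norm x)\<^sup>2 / 2)"

lemma gaussian_measurable [measurable]: "gaussian \<in> borel_measurable borel"
  unfolding gaussian_def by measurable

lemma gaussian_char_1d:
  fixes s :: real
  shows "integrable lborel (\<lambda>t. exp (- \<i> * complex_of_real (t * s)) * complex_of_real (exp (- t\<^sup>2 / 2)))"
    and "(LINT t|lborel. exp (- \<i> * complex_of_real (t * s)) * complex_of_real (exp (- t\<^sup>2 / 2)))
      = complex_of_real (sqrt (2 * pi) * exp (- s\<^sup>2 / 2))"
proof -
  let ?e = "\<lambda>t. exp (- \<i> * complex_of_real (t * s))"
  have eq: "?e t * complex_of_real (exp (- t\<^sup>2 / 2)) = complex_of_real (sqrt (2 * pi)) * (std_normal_density t *\<^sub>R ?e t)" for t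
    by (simp add: std_normal_density_def scaleR_conv_of_real field_simps)
  have "integrable lborel (\<lambda>t. std_normal_density t *\<^sub>R ?e t)"
  proof (rule Bochner_Integration.integrable_bound)
    show "integrable lborel std_normal_density"
      by (rule integrable_normal_density) simp
    show "AE t in lborel. norm (std_normal_density t *\<^sub>R ?e t) \<le> norm (std_normal_density t)"
      by (simp only: norm_scaleR norm_fourier_kernel) simp
  qed measurable
  then show "integrable lborel (\<lambda>t. ?e t * complex_of_real (exp (- t\<^sup>2 / 2)))"
    unfolding eq by (rule integrable_mult_right)
  have "char std_normal_distribution (- s) = (LINT t|lborel. std_normal_density t *\<^sub>R ?e t)"
    unfolding char_def by (subst integral_density) (auto simp: normal_density_nonneg mult_ac)
  then have "(LINT t|lborel. std_normal_density t *\<^sub>R ?e t) = complex_of_real (exp (- s\<^sup>2 / 2))"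
    by (simp add: char_std_normal_distribution)
  then show "(LINT t|lborel. ?e t * complex_of_real (exp (- t\<^sup>2 / 2))) = complex_of_real (sqrt (2 * pi) * exp (- s\<^sup>2 / 2))"
    unfolding eq integral_mult_right_zero by simp
qed

lemma normaliser_mult_sqrt: "normaliser TYPE('n::finite) * sqrt (2 * pi) ^ CARD('n) = 1"
  by (simp add: normaliser_def powr_minus powr_half_sqrt[symmetric] powr_realpow[symmetric] powr_powr field_simps)

lemma
  shows integrable_gaussian: "integrable lborel (gaussian :: real ^ 'n::finite \<Rightarrow> real)"
    and fourier_gaussian: "fourier (\<lambda>x. complex_of_real (gaussian x)) \<xi> = complex_of_real (gaussian (\<xi> :: real ^ 'n))"
proof -
  have prod: "(\<Prod>b\<in>Basis. exp (- \<i> * complex_of_real ((x \<bullet> b) * (\<xi> \<bullet> b))) * complex_of_real (exp (- (x \<bullet> b)\<^sup>2 / 2)))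
     = exp (- \<i> * complex_of_real (x \<bullet> \<xi>)) * complex_of_real (gaussian x)" for x \<xi> :: "real ^ 'n"
  proof -
    have "exp (- (norm x)\<^sup>2 / 2) = (\<Prod>b\<in>Basis. exp (- (x \<bullet> b)\<^sup>2 / 2))"
      unfolding power2_norm_eq_inner euclidean_inner[of x x] exp_sum[OF finite_Basis, symmetric]
      by (simp add: sum_negf sum_divide_distrib power2_eq_square)
    moreover have "exp (- \<i> * complex_of_real (x \<bullet> \<xi>)) = (\<Prod>b\<in>Basis. exp (- \<i> * complex_of_real ((x \<bullet> b) * (\<xi> \<bullet> b))))"
      unfolding euclidean_inner[of x \<xi>] exp_sum[OF finite_Basis, symmetric]
      by (simp add: sum_negf sum_distrib_left)
    ultimately show ?thesis
      by (simp add: gaussian_def prod.distrib)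
  qed
  note p = integrable_lborel_prod_Basis[OF gaussian_char_1d(1), where 'a = "real ^ 'n"]
    integral_lborel_prod_Basis[OF gaussian_char_1d(1), where 'a = "real ^ 'n"]
  have "integrable lborel (\<lambda>x::real^'n. complex_of_real (gaussian x))"
    using p(1)[of "\<lambda>_. 0"] prod[of _ 0] by (simp only: inner_zero_left) simp
  then show "integrable lborel (gaussian :: real ^ 'n \<Rightarrow> real)"
    by (simp add: complex_of_real_integrable_eq)
  have "(LINT x|lborel. exp (- \<i> * complex_of_real (x \<bullet> \<xi>)) * complex_of_real (gaussian x))
      = (\<Prod>b\<in>Basis. complex_of_real (sqrt (2 * pi) * exp (- (\<xi> \<bullet> b)\<^sup>2 / 2)))"
    unfolding prod[symmetric] p(2) gaussian_char_1d(2) ..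
  also have "\<dots> = complex_of_real (sqrt (2 * pi) ^ CARD('n) * (\<Prod>b\<in>Basis. exp (- (\<xi> \<bullet> b)\<^sup>2 / 2)))"
    by (simp add: prod.distrib)
  also have "(\<Prod>b\<in>Basis. exp (- (\<xi> \<bullet> b)\<^sup>2 / 2)) = gaussian \<xi>"
    unfolding gaussian_def power2_norm_eq_inner euclidean_inner[of \<xi> \<xi>] exp_sum[OF finite_Basis, symmetric]
    by (simp add: sum_negf sum_divide_distrib power2_eq_square)
  finally have "fourier (\<lambda>x. complex_of_real (gaussian x)) \<xi>
     = complex_of_real (normaliser TYPE('n) * sqrt (2 * pi) ^ CARD('n) * gaussian \<xi>)"
    by (simp add: fourier_def normaliser_def mult.assoc)
  then show "fourier (\<lambda>x. complex_of_real (gaussian x)) \<xi> = complex_of_real (gaussian \<xi>)"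
    by (simp only: normaliser_mult_sqrt mult_1)
qed

section \<open>Square integrable functions\<close>

text \<open>
  The square of the \<open>L\<^sup>2\<close> norm. It takes values in the extended nonnegative reals and is itself an
  integral, so that the convergence theorems apply to it without a square root in between.
\<close>

definition L2_sq :: "('a::euclidean_space \<Rightarrow> complex) \<Rightarrow> ennreal" where
  "L2_sq f = (\<integral>\<^sup>+x. ennreal ((norm (f x))\<^sup>2) \<partial>lborel)"

lemma L2_sq_mono_AE:
  assumes "AE x in lborel. norm (f x) \<le> norm (g x)"
  shows "L2_sq f \<le> L2_sq g"
  unfolding L2_sq_def using assms by (intro nn_integral_mono_AE) (auto simp: power_mono)

lemma pairing_bound:
  fixes f g :: "'a::euclidean_space \<Rightarrow> complex"
  assumes [measurable]: "f \<in> borel_measurable borel" "g \<in> borel_measurable borel"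
  shows "(\<integral>\<^sup>+x. ennreal (norm (f x * g x)) \<partial>lborel)\<^sup>2 \<le> L2_sq f * L2_sq g"
  using Cauchy_Schwarz_nn_integral[of "\<lambda>x. ennreal (norm (f x))" lborel "\<lambda>x. ennreal (norm (g x))"]
  by (simp add: L2_sq_def norm_mult ennreal_mult ennreal_power)

lemma integrable_pairing:
  fixes f g :: "'a::euclidean_space \<Rightarrow> complex"
  assumes [measurable]: "f \<in> borel_measurable borel" "g \<in> borel_measurable borel"
    and "L2_sq f < \<infinity>" "L2_sq g < \<infinity>"
  shows "integrable lborel (\<lambda>x. f x * g x)"
proof -
  have "(\<integral>\<^sup>+x. ennreal (norm (f x * g x)) \<partial>lborel)\<^sup>2 < \<infinity>"
    using assms(3,4) by (intro le_less_trans[OF pairing_bound]) (auto simp: ennreal_mult_less_top)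
  then have "(\<integral>\<^sup>+x. ennreal (norm (f x * g x)) \<partial>lborel) < \<infinity>"
    by (simp add: power2_eq_square ennreal_mult_less_top less_top[symmetric] ennreal_mult_eq_top_iff)
  then show ?thesis
    by (simp add: integrable_iff_bounded)
qed

lemma pairing_tendsto:
  fixes f :: "nat \<Rightarrow> 'a::euclidean_space \<Rightarrow> complex"
  assumes m [measurable]: "\<And>n. f n \<in> borel_measurable borel" "F \<in> borel_measurable borel" "g \<in> borel_measurable borel"
    and fin: "\<And>n. L2_sq (f n) < \<infinity>" "L2_sq F < \<infinity>" "L2_sq g < \<infinity>"
    and conv: "(\<lambda>n. L2_sq (\<lambda>x. F x - f n x)) \<longlonglongrightarrow> 0"
  shows "(\<lambda>n. LINT x|lborel. f n x * g x) \<longlonglongrightarrow> (LINT x|lborel. F x * g x)"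
proof -
  define d where "d n = (LINT x|lborel. F x * g x) - (LINT x|lborel. f n x * g x)" for n
  have i: "integrable lborel (\<lambda>x. F x * g x)" "integrable lborel (\<lambda>x. f n x * g x)" for n
    by (intro integrable_pairing m fin)+
  have bound: "ennreal ((norm (d n))\<^sup>2) \<le> L2_sq (\<lambda>x. F x - f n x) * L2_sq g" for n
  proof -
    have "d n = (LINT x|lborel. (F x - f n x) * g x)"
      using i by (simp add: d_def left_diff_distrib)
    moreover have "integrable lborel (\<lambda>x. (F x - f n x) * g x)"
      using i by (simp add: left_diff_distrib)
    ultimately have "ennreal (norm (d n)) \<le> (\<integral>\<^sup>+x. ennreal (norm ((F x - f n x) * g x)) \<partial>lborel)"
      by (simp add: integral_norm_bound_ennreal)
    then have "(ennreal (norm (d n)))\<^sup>2 \<le> (\<integral>\<^sup>+x. ennreal (norm ((F x - f n x) * g x)) \<partial>lborel)\<^sup>2"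
      by (rule power_mono) simp
    also have "\<dots> \<le> L2_sq (\<lambda>x. F x - f n x) * L2_sq g"
      by (rule pairing_bound) measurable
    finally show ?thesis
      by (simp add: ennreal_power)
  qed
  have "(\<lambda>n. L2_sq g * L2_sq (\<lambda>x. F x - f n x)) \<longlonglongrightarrow> L2_sq g * 0"
    using fin(3) by (intro ennreal_tendsto_cmult conv) simp
  then have lim: "(\<lambda>n. L2_sq g * L2_sq (\<lambda>x. F x - f n x)) \<longlonglongrightarrow> ennreal 0"
    by simp
  have "(\<lambda>n. ennreal ((norm (d n))\<^sup>2)) \<longlonglongrightarrow> ennreal 0"
  proof (rule tendsto_sandwich[OF _ _ _ lim])
    show "(\<lambda>_. 0) \<longlonglongrightarrow> ennreal 0"
      by simp
    show "\<forall>\<^sub>F n in sequentially. ennreal ((norm (d n))\<^sup>2) \<le> L2_sq g * L2_sq (\<lambda>x. F x - f n x)"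
      using bound by (simp add: mult.commute)
  qed simp_all
  then have "(\<lambda>n. (norm (d n))\<^sup>2) \<longlonglongrightarrow> 0"
    by (subst (asm) tendsto_ennreal_iff) auto
  then have "d \<longlonglongrightarrow> 0"
    by (simp add: tendsto_null_power tendsto_norm_zero_iff)
  then have "(\<lambda>n. (LINT x|lborel. F x * g x) - d n) \<longlonglongrightarrow> (LINT x|lborel. F x * g x) - 0"
    by (intro tendsto_intros)
  then show ?thesis
    by (simp add: d_def)
qed

text \<open>
  Completeness of \<open>L\<^sup>2\<close> for sequences that converge geometrically. The increments
  \<open>D j = norm (h (Suc j) - h j)\<close> have
  \<open>\<integral> (\<Sum>j. 2 ^ j * (D j)\<^sup>2) < \<infinity>\<close>, whence \<open>D j \<le> (1 / sqrt 2) ^ j\<close> eventually at almost every point and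
  the sequence converges there. The bounds pass to the limit by Fatou's lemma.
\<close>

lemma L2_sq_geometric_limit:
  fixes h :: "nat \<Rightarrow> 'a::euclidean_space \<Rightarrow> complex"
  assumes m [measurable]: "\<And>n. h n \<in> borel_measurable borel"
    and cauchy: "\<And>i j. j \<le> i \<Longrightarrow> L2_sq (\<lambda>x. h i x - h j x) \<le> ennreal ((1/4) ^ j)"
    and bdd: "\<And>n. L2_sq (h n) \<le> K"
  shows "\<exists>H\<in>borel_measurable borel. L2_sq H \<le> K \<and> (\<forall>j. L2_sq (\<lambda>x. H x - h j x) \<le> ennreal ((1/4) ^ j))"
proof -
  define H where "H x = lim (\<lambda>n. h n x)" for x
  have [measurable]: "H \<in> borel_measurable borel"
    unfolding H_def by measurable
  have conv: "AE x in lborel. (\<lambda>n. h n x) \<longlonglongrightarrow> H x"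
  proof -
    define D where "D j x = norm (h (Suc j) x - h j x)" for j x
    have [measurable]: "D j \<in> borel_measurable borel" for j
      unfolding D_def by measurable
    have "(\<integral>\<^sup>+x. (\<Sum>j. ennreal (2 ^ j * (D j x)\<^sup>2)) \<partial>lborel) = (\<Sum>j. \<integral>\<^sup>+x. ennreal (2 ^ j * (D j x)\<^sup>2) \<partial>lborel)"
      by (rule nn_integral_suminf) measurable
    also have "\<dots> \<le> (\<Sum>j. ennreal ((1/2) ^ j))"
    proof (rule suminf_le)
      fix j
      have "(\<integral>\<^sup>+x. ennreal (2 ^ j * (D j x)\<^sup>2) \<partial>lborel) = ennreal (2 ^ j) * L2_sq (\<lambda>x. h (Suc j) x - h j x)"
        by (simp add: L2_sq_def D_def ennreal_mult nn_integral_cmult)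
      also have "\<dots> \<le> ennreal (2 ^ j) * ennreal ((1/4) ^ j)"
        by (intro mult_left_mono cauchy) auto
      also have "\<dots> = ennreal ((1/2) ^ j)"
        by (simp add: ennreal_mult[symmetric] power_mult_distrib[symmetric])
      finally show "(\<integral>\<^sup>+x. ennreal (2 ^ j * (D j x)\<^sup>2) \<partial>lborel) \<le> ennreal ((1/2) ^ j)" .
    qed auto
    also have "\<dots> < \<infinity>"
      by (subst suminf_ennreal2) (auto simp: summable_geometric)
    finally have "AE x in lborel. (\<Sum>j. ennreal (2 ^ j * (D j x)\<^sup>2)) \<noteq> \<infinity>"
      by (intro nn_integral_PInf_AE) auto
    then show ?thesis
    proof (rule AE_mp, intro AE_I2 impI)
      fix x assume "(\<Sum>j. ennreal (2 ^ j * (D j x)\<^sup>2)) \<noteq> \<infinity>"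
      then have "summable (\<lambda>j. 2 ^ j * (D j x)\<^sup>2)"
        by (intro summable_suminf_not_top) auto
      then have "(\<lambda>j. 2 ^ j * (D j x)\<^sup>2) \<longlonglongrightarrow> 0"
        by (rule summable_LIMSEQ_zero)
      then have "\<forall>\<^sub>F j in sequentially. 2 ^ j * (D j x)\<^sup>2 < 1"
        by (rule order_tendstoD) simp
      then have "\<forall>\<^sub>F j in sequentially. norm (h (Suc j) x - h j x) \<le> (1 / sqrt 2) ^ j"
      proof eventually_elim
        case (elim j)
        have sq: "((1 / sqrt 2) ^ j)\<^sup>2 = (1 / 2 :: real) ^ j"
          unfolding power2_eq_square power_mult_distrib[symmetric] by simp
        have "(D j x)\<^sup>2 \<le> (1 / 2) ^ j"
          using elim by (simp add: power_one_over pos_le_divide_eq mult.commute)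
        then have "(D j x)\<^sup>2 \<le> ((1 / sqrt 2) ^ j)\<^sup>2"
          unfolding sq .
        then show ?case
          using power2_le_imp_le[of "D j x" "(1 / sqrt 2) ^ j"] by (simp add: D_def)
      qed
      then have "summable (\<lambda>j. h (Suc j) x - h j x)"
        by (rule summable_comparison_test_ev) (auto intro!: summable_geometric)
      then have "convergent (\<lambda>n. h n x)"
        using sum_lessThan_telescope[of "\<lambda>i. h i x"]
        by (simp add: summable_iff_convergent convergent_diff_const_right_iff)
      then show "(\<lambda>n. h n x) \<longlonglongrightarrow> H x"
        unfolding H_def by (simp add: convergent_LIMSEQ_iff)
    qed
  qed
  have fatou: "L2_sq (\<lambda>x. H x - g x) \<le> B"
    if [measurable]: "g \<in> borel_measurable borel" and B: "\<And>i. i \<ge> j \<Longrightarrow> L2_sq (\<lambda>x. h i x - g x) \<le> B" for g j B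
  proof -
    have "L2_sq (\<lambda>x. H x - g x) = (\<integral>\<^sup>+x. liminf (\<lambda>i. ennreal ((norm (h i x - g x))\<^sup>2)) \<partial>lborel)"
      unfolding L2_sq_def
    proof (rule nn_integral_cong_AE, use conv in eventually_elim)
      fix x assume "(\<lambda>n. h n x) \<longlonglongrightarrow> H x"
      then have "(\<lambda>i. ennreal ((norm (h i x - g x))\<^sup>2)) \<longlonglongrightarrow> ennreal ((norm (H x - g x))\<^sup>2)"
        by (intro tendsto_intros)
      then show "ennreal ((norm (H x - g x))\<^sup>2) = liminf (\<lambda>i. ennreal ((norm (h i x - g x))\<^sup>2))"
        by (intro lim_imp_Liminf[symmetric]) auto
    qed
    also have "\<dots> \<le> liminf (\<lambda>i. L2_sq (\<lambda>x. h i x - g x))"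
      unfolding L2_sq_def by (rule nn_integral_liminf) measurable
    also have "\<dots> \<le> liminf (\<lambda>i. B)"
      by (rule Liminf_mono) (auto simp: eventually_sequentially intro!: exI[of _ j] B)
    finally show ?thesis
      by (simp add: Liminf_const)
  qed
  show ?thesis
  proof (intro bexI conjI allI)
    show "L2_sq H \<le> K"
      using fatou[of "\<lambda>_. 0" 0 K] bdd by simp
    show "L2_sq (\<lambda>x. H x - h j x) \<le> ennreal ((1/4) ^ j)" for j
      by (rule fatou[of _ j]) (auto intro: cauchy)
  qed measurable
qed

section \<open>Plancherel and Parseval\<close>

lemma gaussian_bounds: "0 < gaussian x" "gaussian x \<le> 1"
  by (auto simp: gaussian_def)

lemma normaliser_pos: "normaliser TYPE('n::finite) > 0"
  by (simp add: normaliser_def)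

lemma integral_gaussian:
  "normaliser TYPE('n::finite) * (LINT x|lborel. gaussian (x :: real ^ 'n)) = 1"
  using fourier_gaussian[of "0 :: real ^ 'n"]
  by (simp add: fourier_def normaliser_def gaussian_def[of 0] flip: of_real_mult)

lemma nn_integral_gaussian:
  "ennreal (normaliser TYPE('n::finite)) * (\<integral>\<^sup>+x. ennreal (gaussian (x :: real ^ 'n)) \<partial>lborel) = 1"
proof -
  have "(\<integral>\<^sup>+x. ennreal (gaussian (x :: real ^ 'n)) \<partial>lborel) = ennreal (LINT x|lborel. gaussian (x :: real ^ 'n))"
    by (rule nn_integral_eq_integral[OF integrable_gaussian]) (simp add: gaussian_bounds less_imp_le)
  then show ?thesis
    using integral_gaussian[where 'n = 'n]
    by (simp add: normaliser_pos less_imp_le gaussian_bounds flip: ennreal_mult)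
qed

lemma integrable_dilated_gaussian:
  assumes "k > 0"
  shows "integrable lborel (\<lambda>x::real^'n::finite. complex_of_real (gaussian ((1 / k) *\<^sub>R x)))"
  using integrable_lborel_affine[OF integrable_gaussian, of "1 / k" 0] assms
  by (simp add: complex_of_real_integrable_eq)

lemma fourier_modulated_gaussian:
  fixes \<xi> \<eta> :: "real ^ 'n::finite"
  assumes k: "k > 0"
  shows "fourier (\<lambda>x. exp (- \<i> * complex_of_real (x \<bullet> (- \<eta>))) * complex_of_real (gaussian ((1 / k) *\<^sub>R x))) \<xi>
    = complex_of_real (k ^ CARD('n) * gaussian (k *\<^sub>R (\<xi> - \<eta>)))"
proof -
  have kern: "exp (- \<i> * complex_of_real ((k *\<^sub>R y) \<bullet> \<xi>)) * (exp (- \<i> * complex_of_real ((k *\<^sub>R y) \<bullet> (- \<eta>))) * c)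
      = exp (- \<i> * complex_of_real (y \<bullet> (k *\<^sub>R (\<xi> - \<eta>)))) * c" for y c
    unfolding mult.assoc[symmetric] exp_add[symmetric]
    by (simp add: inner_diff_right algebra_simps)
  have "(LINT x|lborel. exp (- \<i> * complex_of_real (x \<bullet> \<xi>)) *
      (exp (- \<i> * complex_of_real (x \<bullet> (- \<eta>))) * complex_of_real (gaussian ((1 / k) *\<^sub>R x))))
    = k ^ CARD('n) *\<^sub>R (LINT y|lborel. exp (- \<i> * complex_of_real (y \<bullet> (k *\<^sub>R (\<xi> - \<eta>)))) * complex_of_real (gaussian y))"
    by (subst integral_lborel_affine[where c = k and t = 0]) (use k in \<open>simp_all only: add_0 kern\<close>, simp_all)
  then have "fourier (\<lambda>x. exp (- \<i> * complex_of_real (x \<bullet> (- \<eta>))) * complex_of_real (gaussian ((1 / k) *\<^sub>R x))) \<xi>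
    = k ^ CARD('n) *\<^sub>R fourier (\<lambda>y. complex_of_real (gaussian y)) (k *\<^sub>R (\<xi> - \<eta>))"
    by (simp only: fourier_def mult_scaleR_right)
  then show ?thesis
    by (simp only: fourier_gaussian) (simp add: scaleR_conv_of_real)
qed

text \<open>
  Cutting off the Fourier transform by a Gaussian of width \<open>k\<close> and transforming back yields a Gaussian
  average of \<open>\<phi>\<close> at scale \<open>1 / k\<close>.
\<close>

lemma fourier_gaussian_cutoff:
  fixes \<phi> :: "real ^ 'n::finite \<Rightarrow> complex"
  assumes \<phi>: "integrable lborel \<phi>" and k: "k > 0"
  shows "fourier (\<lambda>x. complex_of_real (gaussian ((1 / k) *\<^sub>R x)) * fourier \<phi> x) (- \<eta>)
    = normaliser TYPE('n) * (LINT z|lborel. gaussian z * \<phi> (\<eta> + (1 / k) *\<^sub>R z))"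
proof -
  have [measurable]: "\<phi> \<in> borel_measurable borel"
    using \<phi> by simp
  define g where "g x = exp (- \<i> * complex_of_real (x \<bullet> (- \<eta>))) * complex_of_real (gaussian ((1 / k) *\<^sub>R x))"
    for x :: "real ^ 'n"
  have g: "integrable lborel g"
    unfolding g_def by (rule integrable_fourier_kernel[OF integrable_dilated_gaussian[OF k]])
  have "fourier (\<lambda>x. complex_of_real (gaussian ((1 / k) *\<^sub>R x)) * fourier \<phi> x) (- \<eta>)
     = normaliser TYPE('n) * (LINT x|lborel. g x * fourier \<phi> x)"
    by (simp add: fourier_def[of "\<lambda>x. _ x * _ x"] normaliser_def g_def mult.assoc)
  also have "(LINT x|lborel. g x * fourier \<phi> x) = (LINT x|lborel. fourier g x * \<phi> x)"
    by (rule fourier_multiplication[OF g \<phi>])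
  also have "\<dots> = (LINT x|lborel. complex_of_real (k ^ CARD('n) * gaussian (k *\<^sub>R (x - \<eta>))) * \<phi> x)"
    unfolding g_def fourier_modulated_gaussian[OF k] ..
  also have "\<dots> = (LINT z|lborel. gaussian z * \<phi> (\<eta> + (1 / k) *\<^sub>R z))"
    by (subst integral_lborel_affine[where c = "1 / k" and t = \<eta>])
      (use k in \<open>simp_all add: scaleR_conv_of_real[where 'a = complex] power_divide mult.assoc\<close>)
  finally show ?thesis .
qed

text \<open>
  With the cutoff every integral converges absolutely, and the multiplication formula moves the
  Fourier transform from \<open>f\<close> to the cut-off transform of \<open>\<phi>\<close>. Letting \<open>k\<close> tend to infinity gives the
  Plancherel inequality (with \<open>\<phi> = cnj f\<close>) and then the Parseval identity.
\<close>

lemma regularised_parseval: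
  fixes f \<phi> :: "real ^ 'n::finite \<Rightarrow> complex"
  assumes f: "integrable lborel f" and \<phi>: "integrable lborel \<phi>" and k: "k > 0"
  shows "(LINT x|lborel. fourier f (- x) * (complex_of_real (gaussian ((1 / k) *\<^sub>R x)) * fourier \<phi> x))
    = (LINT \<eta>|lborel. f \<eta> * (normaliser TYPE('n) * (LINT z|lborel. gaussian z * \<phi> (\<eta> + (1 / k) *\<^sub>R z))))"
proof -
  have [measurable]: "f \<in> borel_measurable borel" "\<phi> \<in> borel_measurable borel"
    using f \<phi> by simp_all
  let ?w = "\<lambda>x. complex_of_real (gaussian ((1 / k) *\<^sub>R x)) * fourier \<phi> x"
  have w: "integrable lborel ?w"
  proof (rule Bochner_Integration.integrable_bound)
    let ?B = "normaliser TYPE('n) * (LINT x|lborel. norm (\<phi> x))"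
    show "integrable lborel (\<lambda>x. complex_of_real (gaussian ((1 / k) *\<^sub>R x)) * complex_of_real ?B)"
      by (intro integrable_mult_left integrable_dilated_gaussian k)
    show "AE x in lborel. norm (?w x) \<le> norm (complex_of_real (gaussian ((1 / k) *\<^sub>R x)) * complex_of_real ?B)"
      unfolding norm_mult norm_of_real
      by (intro AE_I2 mult_left_mono order_trans[OF fourier_bounded]) (auto simp: abs_mult abs_of_pos[OF normaliser_pos])
  qed measurable
  have r: "integrable lborel (\<lambda>x. f (- x))"
    using integrable_lborel_affine[OF f, of "-1" 0] by simp
  have "(LINT x|lborel. fourier f (- x) * ?w x) = (LINT x|lborel. f (- x) * fourier ?w x)"
    using fourier_multiplication[OF r w] by (simp add: fourier_reflect)
  also have "\<dots> = (LINT \<eta>|lborel. f \<eta> * fourier ?w (- \<eta>))"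
    by (subst integral_lborel_affine[where c = "-1" and t = 0]) auto
  finally show ?thesis
    by (simp only: fourier_gaussian_cutoff[OF \<phi> k])
qed

lemma L2_sq_reflect:
  assumes [measurable]: "f \<in> borel_measurable borel"
  shows "L2_sq (\<lambda>x. f (- x)) = L2_sq f"
  unfolding L2_sq_def by (subst (2) nn_integral_lborel_affine[where c = "-1" and t = 0]) auto

lemma norm_integral_le_nn_integral:
  fixes f :: "'a \<Rightarrow> complex"
  shows "ennreal (norm (LINT x|M. f x)) \<le> (\<integral>\<^sup>+x. ennreal (norm (f x)) \<partial>M)"
  by (cases "integrable M f") (auto simp: integral_norm_bound_ennreal not_integrable_integral_eq)

text \<open>
  By \<open>x y \<le> (x\<^sup>2 + y\<^sup>2) / 2\<close> it suffices that averaging over translates with total weight 1 preserves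
  the integral of \<open>(norm f)\<^sup>2\<close>.
\<close>

lemma gaussian_average_pairing_le_L2_sq:
  fixes f :: "real ^ 'n::finite \<Rightarrow> complex"
  assumes [measurable]: "f \<in> borel_measurable borel"
  shows "ennreal (norm (LINT \<eta>|lborel. f \<eta> * (normaliser TYPE('n) * (LINT z|lborel. gaussian z * cnj (f (\<eta> + s *\<^sub>R z))))))
    \<le> L2_sq f"
proof -
  let ?c = "ennreal (normaliser TYPE('n))"
  define F where "F x = ennreal ((norm (f x))\<^sup>2)" for x
  have [measurable]: "F \<in> borel_measurable borel"
    unfolding F_def by measurable
  have shift: "(\<integral>\<^sup>+\<eta>. F (\<eta> + v) \<partial>lborel) = L2_sq f" for v
    unfolding L2_sq_def F_def
    by (subst (2) nn_integral_lborel_affine[where c = 1 and t = v]) (auto simp: add.commute)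
  have young: "ennreal (norm (f x)) * (ennreal (gaussian z) * ennreal (norm (f y))) \<le> ennreal (gaussian z) * ((F x + F y) / 2)" for x y z
  proof -
    have "norm (f x) * norm (f y) \<le> ((norm (f x))\<^sup>2 + (norm (f y))\<^sup>2) / 2"
      using sum_squares_bound[of "norm (f x)" "norm (f y)"] by simp
    then have "norm (f x) * (gaussian z * norm (f y)) \<le> gaussian z * (((norm (f x))\<^sup>2 + (norm (f y))\<^sup>2) / 2)"
      using mult_left_mono[OF _ less_imp_le[OF gaussian_bounds(1)[of z]]] by (subst mult.left_commute) blast
    from ennreal_leI[OF this] show ?thesis
      by (simp add: F_def ennreal_mult gaussian_bounds less_imp_le ennreal_plus[symmetric] divide_ennreal[symmetric] ennreal_times_divide
        del: ennreal_plus)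
  qed
  have "ennreal (norm (LINT \<eta>|lborel. f \<eta> * (normaliser TYPE('n) * (LINT z|lborel. gaussian z * cnj (f (\<eta> + s *\<^sub>R z))))))
     \<le> (\<integral>\<^sup>+\<eta>. ennreal (norm (f \<eta> * (normaliser TYPE('n) * (LINT z|lborel. gaussian z * cnj (f (\<eta> + s *\<^sub>R z)))))) \<partial>lborel)"
    by (rule norm_integral_le_nn_integral)
  also have "\<dots> \<le> (\<integral>\<^sup>+\<eta>. (\<integral>\<^sup>+z. ?c * (ennreal (gaussian z) * ((F \<eta> + F (\<eta> + s *\<^sub>R z)) / 2)) \<partial>lborel) \<partial>lborel)"
  proof (rule nn_integral_mono)
    fix \<eta> :: "real ^ 'n"
    have "ennreal (norm (f \<eta> * (normaliser TYPE('n) * (LINT z|lborel. gaussian z * cnj (f (\<eta> + s *\<^sub>R z))))))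
       = ?c * ennreal (norm (f \<eta>)) * ennreal (norm (LINT z|lborel. gaussian z * cnj (f (\<eta> + s *\<^sub>R z))))"
      by (simp add: norm_mult ennreal_mult abs_of_pos[OF normaliser_pos] less_imp_le[OF normaliser_pos] mult_ac)
    also have "\<dots> \<le> ?c * ennreal (norm (f \<eta>)) *
        (\<integral>\<^sup>+z. ennreal (norm (complex_of_real (gaussian z) * cnj (f (\<eta> + s *\<^sub>R z)))) \<partial>lborel)"
      by (intro mult_left_mono norm_integral_le_nn_integral) auto
    also have "\<dots> = (\<integral>\<^sup>+z. ?c * (ennreal (norm (f \<eta>)) * (ennreal (gaussian z) * ennreal (norm (f (\<eta> + s *\<^sub>R z))))) \<partial>lborel)"
      by (simp add: norm_mult ennreal_mult abs_of_pos[OF gaussian_bounds(1)] gaussian_bounds less_imp_le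
          nn_integral_cmult mult.assoc)
    also have "\<dots> \<le> (\<integral>\<^sup>+z. ?c * (ennreal (gaussian z) * ((F \<eta> + F (\<eta> + s *\<^sub>R z)) / 2)) \<partial>lborel)"
      by (intro nn_integral_mono mult_left_mono young) auto
    finally show "ennreal (norm (f \<eta> * (normaliser TYPE('n) * (LINT z|lborel. gaussian z * cnj (f (\<eta> + s *\<^sub>R z))))))
      \<le> (\<integral>\<^sup>+z. ?c * (ennreal (gaussian z) * ((F \<eta> + F (\<eta> + s *\<^sub>R z)) / 2)) \<partial>lborel)" .
  qed
  also have "\<dots> = (\<integral>\<^sup>+z. (\<integral>\<^sup>+\<eta>. ?c * (ennreal (gaussian z) * ((F \<eta> + F (\<eta> + s *\<^sub>R z)) / 2)) \<partial>lborel) \<partial>lborel)"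
    by (rule lborel_pair.Fubini') measurable
  also have "\<dots> = (\<integral>\<^sup>+z. ?c * (ennreal (gaussian z) * L2_sq f) \<partial>(lborel :: (real ^ 'n) measure))"
  proof (rule nn_integral_cong)
    fix z :: "real ^ 'n"
    have "(\<integral>\<^sup>+\<eta>. (F \<eta> + F (\<eta> + s *\<^sub>R z)) / 2 \<partial>lborel) = (L2_sq f + L2_sq f) / 2"
      using shift[of 0] shift[of "s *\<^sub>R z"] by (simp add: nn_integral_divide nn_integral_add)
    also have "\<dots> = L2_sq f"
      by (simp add: mult_2[symmetric] ennreal_mult_divide_eq mult.commute[of 2])
    finally show "(\<integral>\<^sup>+\<eta>. ?c * (ennreal (gaussian z) * ((F \<eta> + F (\<eta> + s *\<^sub>R z)) / 2)) \<partial>lborel) = ?c * (ennreal (gaussian z) * L2_sq f)"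
      by (simp add: nn_integral_cmult)
  qed
  also have "\<dots> = (?c * (\<integral>\<^sup>+z. ennreal (gaussian (z :: real ^ 'n)) \<partial>lborel)) * L2_sq f"
    by (simp add: nn_integral_cmult nn_integral_multc mult.assoc)
  finally show ?thesis
    by (simp add: nn_integral_gaussian)
qed

lemma gaussian_cutoff_tendsto: "(\<lambda>n. gaussian ((1 / real (Suc n)) *\<^sub>R x)) \<longlonglongrightarrow> 1"
proof -
  have "(\<lambda>n. (1 / real (Suc n)) *\<^sub>R x) \<longlonglongrightarrow> 0 *\<^sub>R x"
    by (intro tendsto_scaleR tendsto_const LIMSEQ_Suc[OF lim_1_over_n])
  then have "(\<lambda>n. gaussian ((1 / real (Suc n)) *\<^sub>R x)) \<longlonglongrightarrow> exp (- (norm (0 *\<^sub>R x))\<^sup>2 / 2)"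
    unfolding gaussian_def
    by (intro tendsto_exp tendsto_divide tendsto_minus tendsto_power tendsto_norm tendsto_const) simp_all
  then show ?thesis by simp
qed

text \<open>
  The Plancherel inequality, for integrable \<open>f\<close>. By the regularised Parseval formula with
  \<open>\<phi> = cnj f\<close>, the cut-off integral of \<open>(norm (fourier f))\<^sup>2\<close> pairs \<open>f\<close> with a Gaussian average of
  \<open>cnj f\<close>; the cutoff is removed by Fatou's lemma.
\<close>

lemma L2_sq_fourier_le:
  fixes f :: "real ^ 'n::finite \<Rightarrow> complex"
  assumes f: "integrable lborel f"
  shows "L2_sq (fourier f) \<le> L2_sq f"
proof -
  have [measurable]: "f \<in> borel_measurable borel"
    using f by simp
  define w where "w n x = gaussian ((1 / real (Suc n)) *\<^sub>R x)" for n and x :: "real ^ 'n"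
  have [measurable]: "w n \<in> borel_measurable borel" for n
    unfolding w_def by measurable
  have w: "0 < w n x" "w n x \<le> 1" for n x
    unfolding w_def by (rule gaussian_bounds)+
  define h where "h x = fourier f (- x)" for x
  have [measurable]: "h \<in> borel_measurable borel"
    unfolding h_def by measurable
  have cut: "(\<integral>\<^sup>+x. ennreal (w n x * (norm (h x))\<^sup>2) \<partial>lborel) \<le> L2_sq f" for n
  proof -
    let ?B = "normaliser TYPE('n) * (LINT x|lborel. norm (f x))"
    have int: "integrable lborel (\<lambda>x. w n x * (norm (h x))\<^sup>2)"
    proof (rule Bochner_Integration.integrable_bound)
      show "integrable lborel (\<lambda>x. w n x * ?B\<^sup>2)"
        using integrable_dilated_gaussian[of "real (Suc n)", where 'n = 'n]
        by (intro integrable_mult_left) (simp add: w_def complex_of_real_integrable_eq)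
      show "AE x in lborel. norm (w n x * (norm (h x))\<^sup>2) \<le> norm (w n x * ?B\<^sup>2)"
        unfolding norm_mult h_def
        by (intro AE_I2 mult_left_mono) (auto intro!: power_mono fourier_bounded)
    qed measurable
    then have "(\<integral>\<^sup>+x. ennreal (w n x * (norm (h x))\<^sup>2) \<partial>lborel) = ennreal (LINT x|lborel. w n x * (norm (h x))\<^sup>2)"
      by (rule nn_integral_eq_integral) (simp add: w less_imp_le)
    also have "\<dots> \<le> ennreal (norm (complex_of_real (LINT x|lborel. w n x * (norm (h x))\<^sup>2)))"
      by (intro ennreal_leI) simp
    also have "complex_of_real (LINT x|lborel. w n x * (norm (h x))\<^sup>2)
       = (LINT x|lborel. fourier f (- x) * (complex_of_real (gaussian ((1 / real (Suc n)) *\<^sub>R x)) * fourier (\<lambda>x. cnj (f x)) x))"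
      unfolding integral_complex_of_real[symmetric] of_real_mult complex_norm_square
      by (simp add: w_def h_def fourier_cnj mult_ac)
    also have "\<dots> = (LINT \<eta>|lborel. f \<eta> * (normaliser TYPE('n) * (LINT z|lborel. gaussian z * cnj (f (\<eta> + (1 / real (Suc n)) *\<^sub>R z)))))"
      by (rule regularised_parseval[OF f]) (use f in auto)
    also have "ennreal (norm \<dots>) \<le> L2_sq f"
      by (rule gaussian_average_pairing_le_L2_sq) measurable
    finally show ?thesis .
  qed
  have "L2_sq h = (\<integral>\<^sup>+x. liminf (\<lambda>n. ennreal (w n x * (norm (h x))\<^sup>2)) \<partial>lborel)"
    unfolding L2_sq_def
  proof (rule nn_integral_cong)
    fix x
    have "(\<lambda>n. ennreal (w n x * (norm (h x))\<^sup>2)) \<longlonglongrightarrow> ennreal (1 * (norm (h x))\<^sup>2)"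
      unfolding w_def by (intro tendsto_ennrealI tendsto_mult gaussian_cutoff_tendsto tendsto_const)
    then show "ennreal ((norm (h x))\<^sup>2) = liminf (\<lambda>n. ennreal (w n x * (norm (h x))\<^sup>2))"
      using lim_imp_Liminf[OF sequentially_bot] by force
  qed
  also have "\<dots> \<le> liminf (\<lambda>n. \<integral>\<^sup>+x. ennreal (w n x * (norm (h x))\<^sup>2) \<partial>lborel)"
    by (rule nn_integral_liminf) measurable
  also have "\<dots> \<le> liminf (\<lambda>n. L2_sq f)"
    by (intro Liminf_mono always_eventually allI cut)
  finally have "L2_sq h \<le> L2_sq f"
    by (simp add: Liminf_const)
  then show ?thesis
    unfolding h_def by (subst (asm) L2_sq_reflect) measurable
qed

text \<open>
  In the regularised formula, the Plancherel inequality provides the dominating function on the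
  Fourier side, and on the other side the Gaussian averages of \<open>\<phi>\<close> converge to \<open>\<phi>\<close> boundedly.
\<close>

lemma parseval:
  fixes f \<phi> :: "real ^ 'n::finite \<Rightarrow> complex"
  assumes f: "integrable lborel f" "L2_sq f < \<infinity>"
    and \<phi>: "integrable lborel \<phi>" "L2_sq \<phi> < \<infinity>" "\<And>x. norm (\<phi> x) \<le> B" "\<And>x. isCont \<phi> x"
  shows "(LINT x|lborel. fourier f (- x) * fourier \<phi> x) = (LINT x|lborel. f x * \<phi> x)"
proof -
  have [measurable]: "f \<in> borel_measurable borel" "\<phi> \<in> borel_measurable borel"
    using f \<phi> by simp_all
  define k where "k n = real (Suc n)" for n
  have k: "k n > 0" for n
    by (simp add: k_def)
  let ?c = "normaliser TYPE('n)"
  note one = integral_gaussian[where 'n = 'n]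
  have "(\<lambda>n. LINT x|lborel. fourier f (- x) * (complex_of_real (gaussian ((1 / k n) *\<^sub>R x)) * fourier \<phi> x))
      \<longlonglongrightarrow> (LINT x|lborel. fourier f (- x) * fourier \<phi> x)"
  proof (rule integral_dominated_convergence)
    have "L2_sq (\<lambda>x. fourier f (- x)) < \<infinity>" "L2_sq (fourier \<phi>) < \<infinity>"
      using f \<phi> L2_sq_fourier_le by (auto simp: L2_sq_reflect intro: le_less_trans)
    then have "integrable lborel (\<lambda>x. fourier f (- x) * fourier \<phi> x)"
      by (intro integrable_pairing) auto
    then show "integrable lborel (\<lambda>x. norm (fourier f (- x) * fourier \<phi> x))"
      by (rule integrable_norm)
    show "AE x in lborel. norm (fourier f (- x) * (complex_of_real (gaussian ((1 / k n) *\<^sub>R x)) * fourier \<phi> x))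
        \<le> norm (fourier f (- x) * fourier \<phi> x)" for n
      by (rule AE_I2) (auto simp: norm_mult abs_of_pos[OF gaussian_bounds(1)] gaussian_bounds
          less_imp_le intro!: mult_left_mono mult_left_le_one_le)
    show "AE x in lborel. (\<lambda>n. fourier f (- x) * (complex_of_real (gaussian ((1 / k n) *\<^sub>R x)) * fourier \<phi> x))
        \<longlonglongrightarrow> fourier f (- x) * fourier \<phi> x"
    proof (rule AE_I2)
      fix x
      have "(\<lambda>n. fourier f (- x) * (complex_of_real (gaussian ((1 / k n) *\<^sub>R x)) * fourier \<phi> x))
         \<longlonglongrightarrow> fourier f (- x) * (complex_of_real 1 * fourier \<phi> x)"
        unfolding k_def by (intro tendsto_intros gaussian_cutoff_tendsto)
      then show "(\<lambda>n. fourier f (- x) * (complex_of_real (gaussian ((1 / k n) *\<^sub>R x)) * fourier \<phi> x))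
         \<longlonglongrightarrow> fourier f (- x) * fourier \<phi> x"
        by simp
    qed
  qed measurable
  then have lhs: "(\<lambda>n. LINT \<eta>|lborel. f \<eta> * (?c * (LINT z|lborel. gaussian z * \<phi> (\<eta> + (1 / k n) *\<^sub>R z))))
      \<longlonglongrightarrow> (LINT x|lborel. fourier f (- x) * fourier \<phi> x)"
    by (simp only: regularised_parseval[OF f(1) \<phi>(1) k])
  have gi: "integrable lborel (\<lambda>z::real^'n. gaussian z * B)"
    by (intro integrable_mult_left integrable_gaussian)
  have gB: "norm (complex_of_real (gaussian z) * \<phi> y) \<le> gaussian z * B" for z y :: "real ^ 'n"
    using \<phi>(3)[of y] by (simp add: norm_mult abs_of_pos[OF gaussian_bounds(1)] gaussian_bounds mult_left_mono less_imp_le)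
  have rhs: "(\<lambda>n. LINT \<eta>|lborel. f \<eta> * (?c * (LINT z|lborel. gaussian z * \<phi> (\<eta> + (1 / k n) *\<^sub>R z))))
      \<longlonglongrightarrow> (LINT x|lborel. f x * \<phi> x)"
  proof (rule integral_dominated_convergence)
    show "integrable lborel (\<lambda>\<eta>. norm (f \<eta>) * B)"
      using f by (intro integrable_mult_left integrable_norm)
    show "AE \<eta> in lborel. norm (f \<eta> * (?c * (LINT z|lborel. gaussian z * \<phi> (\<eta> + (1 / k n) *\<^sub>R z)))) \<le> norm (f \<eta>) * B" for n
    proof (rule AE_I2)
      fix \<eta>
      have int: "integrable lborel (\<lambda>z. complex_of_real (gaussian z) * \<phi> (\<eta> + (1 / k n) *\<^sub>R z))"
        by (rule Bochner_Integration.integrable_bound[OF gi]) (auto intro!: order_trans[OF gB])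
      have "norm (LINT z|lborel. complex_of_real (gaussian z) * \<phi> (\<eta> + (1 / k n) *\<^sub>R z))
          \<le> (LINT z|lborel. gaussian (z :: real ^ 'n) * B)"
        by (rule order_trans[OF integral_norm_bound Bochner_Integration.integral_mono[OF integrable_norm[OF int] gi gB]])
      then have "?c * norm (LINT z|lborel. complex_of_real (gaussian z) * \<phi> (\<eta> + (1 / k n) *\<^sub>R z))
          \<le> (?c * (LINT z|lborel. gaussian (z :: real ^ 'n))) * B"
        using mult_left_mono[OF _ less_imp_le[OF normaliser_pos]] by (simp add: mult.assoc)
      then show "norm (f \<eta> * (?c * (LINT z|lborel. gaussian z * \<phi> (\<eta> + (1 / k n) *\<^sub>R z)))) \<le> norm (f \<eta>) * B"
        by (simp add: one norm_mult abs_of_pos[OF normaliser_pos] mult_left_mono)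
    qed
    show "AE \<eta> in lborel. (\<lambda>n. f \<eta> * (?c * (LINT z|lborel. gaussian z * \<phi> (\<eta> + (1 / k n) *\<^sub>R z)))) \<longlonglongrightarrow> f \<eta> * \<phi> \<eta>"
    proof (rule AE_I2)
      fix \<eta>
      have "(\<lambda>n. LINT z|lborel. gaussian z * \<phi> (\<eta> + (1 / k n) *\<^sub>R z)) \<longlonglongrightarrow> (LINT z|lborel. complex_of_real (gaussian (z :: real ^ 'n)) * \<phi> \<eta>)"
      proof (rule integral_dominated_convergence[OF _ _ gi])
        show "AE z in lborel. (\<lambda>n. complex_of_real (gaussian z) * \<phi> (\<eta> + (1 / k n) *\<^sub>R z)) \<longlonglongrightarrow> complex_of_real (gaussian z) * \<phi> \<eta>"
        proof (rule AE_I2)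
          fix z
          have "(\<lambda>n. \<eta> + (1 / k n) *\<^sub>R z) \<longlonglongrightarrow> \<eta> + 0 *\<^sub>R z"
            unfolding k_def by (intro tendsto_intros LIMSEQ_Suc[OF lim_1_over_n])
          then have "(\<lambda>n. \<phi> (\<eta> + (1 / k n) *\<^sub>R z)) \<longlonglongrightarrow> \<phi> \<eta>"
            using isCont_tendsto_compose[OF \<phi>(4)[of \<eta>]] by simp
          then show "(\<lambda>n. complex_of_real (gaussian z) * \<phi> (\<eta> + (1 / k n) *\<^sub>R z)) \<longlonglongrightarrow> complex_of_real (gaussian z) * \<phi> \<eta>"
            by (intro tendsto_intros)
        qed
      qed (measurable, auto intro: gB)
      then have "(\<lambda>n. f \<eta> * (?c * (LINT z|lborel. gaussian z * \<phi> (\<eta> + (1 / k n) *\<^sub>R z))))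
          \<longlonglongrightarrow> f \<eta> * (complex_of_real ?c * (complex_of_real (LINT z|lborel. gaussian (z :: real ^ 'n)) * \<phi> \<eta>))"
        by (intro tendsto_intros) simp
      also have "complex_of_real ?c * (complex_of_real (LINT z|lborel. gaussian (z :: real ^ 'n)) * \<phi> \<eta>) = \<phi> \<eta>"
        using one by (simp add: mult.assoc[symmetric] flip: of_real_mult)
      finally show "(\<lambda>n. f \<eta> * (?c * (LINT z|lborel. gaussian z * \<phi> (\<eta> + (1 / k n) *\<^sub>R z)))) \<longlonglongrightarrow> f \<eta> * \<phi> \<eta>" .
    qed
  qed measurable
  show ?thesis
    by (rule LIMSEQ_unique[OF lhs rhs])
qed

section \<open>Inverse Fourier transforms of square integrable functions\<close>

lemma flat_schwartz_weighted_L2_sq: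
  fixes \<phi> :: "real ^ 'n::finite \<Rightarrow> complex"
  assumes "\<phi> \<in> flat_schwartz"
  shows "L2_sq (\<lambda>x. complex_of_real (norm x powr (- a)) * \<phi> x) < \<infinity>"
proof -
  have "(norm (complex_of_real (norm x powr (- a)) * \<phi> x))\<^sup>2 = norm ((norm x powr (- a) * norm (\<phi> x))\<^sup>2)" for x
    by (simp add: norm_mult)
  then show ?thesis
    using flat_schwartz_weighted_square_integrable[OF assms, of a]
    unfolding L2_sq_def integrable_iff_bounded by simp
qed

lemma flat_schwartz_L2_sq:
  fixes \<phi> :: "real ^ 'n::finite \<Rightarrow> complex"
  assumes "\<phi> \<in> flat_schwartz"
  shows "L2_sq \<phi> < \<infinity>"
proof (rule le_less_trans[OF L2_sq_mono_AE flat_schwartz_weighted_L2_sq[OF assms, of 0]])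
  show "AE x in lborel. norm (\<phi> x) \<le> norm (complex_of_real (norm x powr (- 0)) * \<phi> x)"
    using AE_lborel_singleton[of 0] by eventually_elim (simp add: norm_mult)
qed

text \<open>
  The function \<open>h\<close> is the inverse Fourier transform of \<open>G\<close>. Truncations of \<open>G\<close> to balls are integrable,
  and their inverse transforms are given by the integral \<open>fourier (g j) (- x)\<close>. For radii that grow
  fast enough these form a geometric Cauchy sequence by the Plancherel inequality, and Parseval's
  identity passes to the limit.
\<close>

lemma inverse_fourier_exists:
  fixes G :: "real ^ 'n::finite \<Rightarrow> complex"
  assumes [measurable]: "G \<in> borel_measurable borel" and G: "L2_sq G < \<infinity>"
  shows "\<exists>h\<in>borel_measurable borel. L2_sq h \<le> L2_sq G \<and>
    (\<forall>\<phi>\<in>flat_schwartz. (LINT x|lborel. h x * fourier \<phi> x) = (LINT x|lborel. G x * \<phi> x))"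
proof -
  define tail where "tail R = (\<integral>\<^sup>+x. ennreal ((norm (G x))\<^sup>2) * indicator {x. norm x > real R} x \<partial>lborel)" for R :: nat
  have "tail \<longlonglongrightarrow> (\<integral>\<^sup>+x. 0 \<partial>(lborel :: (real ^ 'n) measure))"
    unfolding tail_def
  proof (rule nn_integral_dominated_convergence)
    show "(\<integral>\<^sup>+x. ennreal ((norm (G x))\<^sup>2) \<partial>lborel) < \<infinity>"
      using G by (simp add: L2_sq_def)
    show "AE x in lborel. (\<lambda>R. ennreal ((norm (G x))\<^sup>2) * indicator {x. norm x > real R} x) \<longlonglongrightarrow> 0"
    proof (intro AE_I2 tendsto_eventually)
      fix x :: "real ^ 'n"
      obtain N where "norm x \<le> real N"
        using real_arch_simple by blast
      then show "\<forall>\<^sub>F R in sequentially. ennreal ((norm (G x))\<^sup>2) * indicator {x. norm x > real R} x = 0"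
        by (auto simp: eventually_sequentially intro!: exI[of _ N])
    qed
    show "AE x in lborel. ennreal ((norm (G x))\<^sup>2) * indicator {x. norm x > real R} x \<le> ennreal ((norm (G x))\<^sup>2)" for R
      by (auto simp: indicator_def)
  qed measurable
  then have "\<forall>\<^sub>F R in sequentially. tail R < ennreal ((1/4) ^ j)" for j
    by (intro order_tendstoD(2)[where y = 0]) auto
  then have "\<forall>j. \<exists>N. \<forall>R\<ge>N. tail R < ennreal ((1/4) ^ j)"
    by (simp add: eventually_sequentially)
  then obtain N where N: "\<And>j R. R \<ge> N j \<Longrightarrow> tail R < ennreal ((1/4) ^ j)"
    by metis
  \<comment> \<open>a monotone choice of radii; the summand \<open>j\<close> makes them unbounded\<close>
  define R where "R j = (\<Sum>i\<le>j. N i) + j" for j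
  have R_mono: "R j \<le> R i" if "j \<le> i" for i j
    unfolding R_def using that by (intro add_mono sum_mono2) auto
  have R_tail: "tail (R j) \<le> ennreal ((1/4) ^ j)" for j
  proof -
    have "N j \<le> (\<Sum>i\<le>j. N i)"
      by (rule member_le_sum) auto
    then show ?thesis
      using N[of j "R j"] by (simp add: R_def less_imp_le)
  qed
  define g where "g j x = indicator (cball 0 (real (R j))) x *\<^sub>R G x" for j x
  have [measurable]: "g j \<in> borel_measurable borel" for j
    unfolding g_def by (intro borel_measurable_scaleR borel_measurable_indicator) auto
  have g_le: "norm (g j x) \<le> norm (G x)" for j x
    by (simp add: g_def indicator_def)
  have g_L2_sq: "L2_sq (g j) \<le> L2_sq G" for j
    by (rule L2_sq_mono_AE) (simp add: g_le)
  have g_int: "integrable lborel (g j)" for j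
  proof -
    let ?I = "\<lambda>x. complex_of_real (indicator (cball 0 (real (R j))) (x :: real ^ 'n))"
    have "L2_sq ?I = (\<integral>\<^sup>+x. indicator (cball 0 (real (R j))) (x :: real ^ 'n) \<partial>lborel)"
      unfolding L2_sq_def by (intro nn_integral_cong refl) (simp add: indicator_def)
    also have "\<dots> < \<infinity>"
      using emeasure_lborel_cball_finite[of "0 :: real ^ 'n"] by simp
    finally have I: "L2_sq ?I < \<infinity>" .
    have [measurable]: "cball (0 :: real ^ 'n) (real (R j)) \<in> sets borel"
      by simp
    have "?I \<in> borel_measurable borel"
      by measurable
    then have "integrable lborel (\<lambda>x. ?I x * G x)"
      using G I by (intro integrable_pairing) auto
    then show ?thesis
      by (simp add: g_def[abs_def] scaleR_conv_of_real)
  qed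
  have g_cauchy: "L2_sq (\<lambda>x. g i x - g j x) \<le> ennreal ((1/4) ^ j)" if "j \<le> i" for i j
  proof -
    have "L2_sq (\<lambda>x. g i x - g j x) \<le> tail (R j)"
      unfolding L2_sq_def tail_def using R_mono[OF that]
      by (intro nn_integral_mono) (auto simp: g_def indicator_def)
    then show ?thesis
      using R_tail by (rule order_trans)
  qed
  define h where "h j x = fourier (g j) (- x)" for j x
  have [measurable]: "h j \<in> borel_measurable borel" for j
    unfolding h_def by measurable
  have h_L2_sq: "L2_sq (h j) \<le> L2_sq G" for j
    unfolding h_def using L2_sq_fourier_le[OF g_int, of j] g_L2_sq[of j] by (simp add: L2_sq_reflect)
  have h_cauchy: "L2_sq (\<lambda>x. h i x - h j x) \<le> ennreal ((1/4) ^ j)" if "j \<le> i" for i j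
  proof -
    have int: "integrable lborel (\<lambda>x. g i x - g j x)"
      by (intro Bochner_Integration.integrable_diff g_int)
    have "L2_sq (\<lambda>x. h i x - h j x) = L2_sq (fourier (\<lambda>x. g i x - g j x))"
      using L2_sq_reflect[of "fourier (\<lambda>x. g i x - g j x)"] by (simp add: h_def fourier_diff g_int)
    then show ?thesis
      using L2_sq_fourier_le[OF int] g_cauchy[OF that] by simp
  qed
  obtain H where [measurable]: "H \<in> borel_measurable borel" and H: "L2_sq H \<le> L2_sq G"
    and conv: "\<And>j. L2_sq (\<lambda>x. H x - h j x) \<le> ennreal ((1/4) ^ j)"
    using L2_sq_geometric_limit[of h "L2_sq G"] h_cauchy h_L2_sq by auto
  have "(\<lambda>j. ennreal ((1/4) ^ j)) \<longlonglongrightarrow> ennreal 0"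
    by (intro tendsto_ennrealI LIMSEQ_realpow_zero) auto
  then have H_lim: "(\<lambda>j. L2_sq (\<lambda>x. H x - h j x)) \<longlonglongrightarrow> 0"
    by (intro tendsto_sandwich[of "\<lambda>_. 0" "\<lambda>j. L2_sq (\<lambda>x. H x - h j x)" sequentially "\<lambda>j. ennreal ((1/4) ^ j)"])
      (simp_all add: conv)
  show ?thesis
  proof (intro bexI conjI ballI)
    fix \<phi> :: "real ^ 'n \<Rightarrow> complex" assume \<phi>: "\<phi> \<in> flat_schwartz"
    note [measurable] = flat_schwartz_measurable[OF \<phi>]
    have \<phi>_int: "integrable lborel \<phi>" and \<phi>_L2_sq: "L2_sq \<phi> < \<infinity>"
      using flat_schwartz_integrable[OF \<phi>] flat_schwartz_L2_sq[OF \<phi>] by auto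
    obtain B where B: "\<And>x. norm (\<phi> x) \<le> B"
      using flat_schwartz_decay[OF \<phi>, of 0] by auto
    have F_L2_sq: "L2_sq (fourier \<phi>) < \<infinity>"
      using L2_sq_fourier_le[OF \<phi>_int] \<phi>_L2_sq by (rule le_less_trans)
    have "(\<lambda>j. LINT x|lborel. h j x * fourier \<phi> x) \<longlonglongrightarrow> (LINT x|lborel. H x * fourier \<phi> x)"
      by (rule pairing_tendsto[OF _ _ _ _ _ _ H_lim])
        (use G H h_L2_sq F_L2_sq in \<open>auto intro: le_less_trans\<close>)
    moreover have "(LINT x|lborel. h j x * fourier \<phi> x) = (LINT x|lborel. g j x * \<phi> x)" for j
      unfolding h_def
      by (rule parseval[OF g_int _ \<phi>_int \<phi>_L2_sq B flat_schwartz_continuous[OF \<phi>]])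
        (use G g_L2_sq in \<open>auto intro: le_less_trans\<close>)
    moreover have "(\<lambda>j. LINT x|lborel. g j x * \<phi> x) \<longlonglongrightarrow> (LINT x|lborel. G x * \<phi> x)"
    proof (rule integral_dominated_convergence)
      show "integrable lborel (\<lambda>x. norm (G x * \<phi> x))"
        using G \<phi>_L2_sq by (intro integrable_norm integrable_pairing) auto
      show "AE x in lborel. norm (g j x * \<phi> x) \<le> norm (G x * \<phi> x)" for j
        by (simp add: norm_mult mult_right_mono g_le)
      show "AE x in lborel. (\<lambda>j. g j x * \<phi> x) \<longlonglongrightarrow> G x * \<phi> x"
      proof (intro AE_I2 tendsto_eventually)
        fix x :: "real ^ 'n"
        obtain n where n: "norm x \<le> real n"
          using real_arch_simple by blast
        have "g j x = G x" if "j \<ge> n" for j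
        proof -
          have "real n \<le> real (R j)"
            using that by (simp add: R_def del: of_nat_add of_nat_sum)
          then show ?thesis
            using n by (simp add: g_def)
        qed
        then show "\<forall>\<^sub>F j in sequentially. g j x * \<phi> x = G x * \<phi> x"
          by (auto simp: eventually_sequentially intro!: exI[of _ n])
      qed
    qed measurable
    ultimately show "(LINT x|lborel. H x * fourier \<phi> x) = (LINT x|lborel. G x * \<phi> x)"
      by (simp add: LIMSEQ_unique)
  qed (use H in auto)
qed

lemma L2_norm_square: "(L2_norm f)\<^sup>2 = L2_sq f"
proof (cases "L2_sq f = top")
  case True
  then show ?thesis
    by (simp add: L2_norm_def L2_sq_def Let_def power2_eq_square)
next
  case False
  then show ?thesis
    by (simp add: L2_norm_def L2_sq_def[symmetric] Let_def ennreal_power less_top)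
qed

lemma L2_norm_le_iff: "L2_norm f \<le> L2_norm g \<longleftrightarrow> L2_sq f \<le> L2_sq g"
  unfolding L2_norm_def L2_sq_def[symmetric] Let_def
  by (cases "L2_sq f"; cases "L2_sq g") (auto simp: top_unique)

lemma L2_norm_finite_iff: "L2_norm f < top \<longleftrightarrow> L2_sq f < \<infinity>"
  by (simp add: L2_norm_def L2_sq_def Let_def less_top)

text \<open>
  The factor 2 in place of the constant 1 of Minkowski's inequality comes from
  \<open>(x + y)\<^sup>2 \<le> 2 x\<^sup>2 + 2 y\<^sup>2\<close>; constants are irrelevant for the estimates in question.
\<close>

lemma L2_norm_le_weighted_sum:
  fixes f g1 g2 :: "real ^ 'n::finite \<Rightarrow> complex"
  assumes [measurable]: "g1 \<in> borel_measurable borel" "g2 \<in> borel_measurable borel"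
    and ab: "a \<ge> 0" "b \<ge> 0"
    and le: "AE x in lborel. norm (f x) \<le> a * norm (g1 x) + b * norm (g2 x)"
  shows "L2_norm f \<le> 2 * (ennreal a * L2_norm g1 + ennreal b * L2_norm g2)"
proof -
  have "L2_sq f \<le> (\<integral>\<^sup>+x. ennreal (2 * a\<^sup>2) * ennreal ((norm (g1 x))\<^sup>2) + ennreal (2 * b\<^sup>2) * ennreal ((norm (g2 x))\<^sup>2) \<partial>lborel)"
    unfolding L2_sq_def
  proof (rule nn_integral_mono_AE, use le in eventually_elim)
    fix x assume "norm (f x) \<le> a * norm (g1 x) + b * norm (g2 x)"
    then have "(norm (f x))\<^sup>2 \<le> (a * norm (g1 x) + b * norm (g2 x))\<^sup>2"
      by (intro power_mono) auto
    also have "\<dots> \<le> 2 * a\<^sup>2 * (norm (g1 x))\<^sup>2 + 2 * b\<^sup>2 * (norm (g2 x))\<^sup>2"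
      using sum_squares_bound[of "a * norm (g1 x)" "b * norm (g2 x)"]
      by (simp add: power2_sum power_mult_distrib)
    finally show "ennreal ((norm (f x))\<^sup>2) \<le> ennreal (2 * a\<^sup>2) * ennreal ((norm (g1 x))\<^sup>2) + ennreal (2 * b\<^sup>2) * ennreal ((norm (g2 x))\<^sup>2)"
      by (simp add: ennreal_leI flip: ennreal_mult ennreal_plus)
  qed
  also have "\<dots> = ennreal (2 * a\<^sup>2) * L2_sq g1 + ennreal (2 * b\<^sup>2) * L2_sq g2"
    by (simp add: L2_sq_def nn_integral_add nn_integral_cmult)
  finally have *: "(L2_norm f)\<^sup>2 \<le> ennreal (2 * a\<^sup>2) * (L2_norm g1)\<^sup>2 + ennreal (2 * b\<^sup>2) * (L2_norm g2)\<^sup>2"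
    by (simp add: L2_norm_square)
  show ?thesis
  proof (cases "ennreal a * L2_norm g1 = top \<or> ennreal b * L2_norm g2 = top")
    case True
    then show ?thesis
      by (auto simp: ennreal_mult_eq_top_iff)
  next
    case False
    obtain A where A: "ennreal a * L2_norm g1 = ennreal A" "A \<ge> 0"
      using False by (metis ennreal_cases)
    obtain B where B: "ennreal b * L2_norm g2 = ennreal B" "B \<ge> 0"
      using False by (metis ennreal_cases)
    have "ennreal (2 * a\<^sup>2) * (L2_norm g1)\<^sup>2 = 2 * (ennreal a * L2_norm g1)\<^sup>2"
      using ab by (simp add: power_mult_distrib ennreal_mult ennreal_power mult.assoc)
    moreover have "ennreal (2 * b\<^sup>2) * (L2_norm g2)\<^sup>2 = 2 * (ennreal b * L2_norm g2)\<^sup>2"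
      using ab by (simp add: power_mult_distrib ennreal_mult ennreal_power mult.assoc)
    ultimately have le: "(L2_norm f)\<^sup>2 \<le> ennreal (2 * A\<^sup>2 + 2 * B\<^sup>2)"
      using * A B by (simp add: ennreal_power ennreal_mult)
    then have "L2_norm f \<noteq> top"
      by (auto simp: power2_eq_square top_unique)
    then obtain F where F: "L2_norm f = ennreal F" "F \<ge> 0"
      by (metis ennreal_cases)
    have "F\<^sup>2 \<le> 2 * A\<^sup>2 + 2 * B\<^sup>2"
      using le F A B by (simp add: ennreal_power del: ennreal_plus)
    also have "\<dots> \<le> (2 * (A + B))\<^sup>2"
      using A B by (simp add: power2_eq_square algebra_simps)
    finally have "F \<le> 2 * (A + B)"
      using A B by (intro power2_le_imp_le[of F]) auto
    then have "ennreal F \<le> 2 * (ennreal A + ennreal B)"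
      using A B by (simp add: ennreal_leI flip: ennreal_plus ennreal_numeral ennreal_mult)
    then show ?thesis
      by (simp add: F A B)
  qed
qed

text \<open>
  The inverse Fourier transform of \<open>norm \<xi> powr a * F \<xi>\<close> is a square integrable function that
  represents \<open>|D|\<^sup>a T\<close>, hence a competitor in the infimum.
\<close>

lemma L2_norm_D_le:
  fixes T :: "'n::finite zfunctional"
  assumes F: "has_fourier T F"
    and fin: "L2_norm (\<lambda>\<xi>. complex_of_real (norm \<xi> powr a) * F \<xi>) < top"
  shows "L2_norm_D a T \<le> L2_norm (\<lambda>\<xi>. complex_of_real (norm \<xi> powr a) * F \<xi>)"
proof -
  let ?G = "\<lambda>\<xi>. complex_of_real (norm \<xi> powr a) * F \<xi>"
  have [measurable]: "F \<in> borel_measurable borel"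
    using F by (simp add: has_fourier_def)
  have G: "L2_sq ?G < \<infinity>"
    using fin by (simp only: L2_norm_finite_iff)
  obtain h where [measurable]: "h \<in> borel_measurable borel" and h: "L2_sq h \<le> L2_sq ?G"
    and pair: "\<And>\<phi>. \<phi> \<in> flat_schwartz \<Longrightarrow> (LINT x|lborel. h x * fourier \<phi> x) = (LINT x|lborel. ?G x * \<phi> x)"
    using inverse_fourier_exists[OF _ G] by auto
  have "has_fourier (functional_of h) ?G"
    unfolding has_fourier_def functional_of_def
    using G pair flat_schwartz_L2_sq flat_schwartz_measurable by (auto intro!: integrable_pairing)
  moreover have "h \<in> L2_fun"
    using h G by (simp add: L2_fun_def L2_norm_finite_iff le_less_trans)
  ultimately have "is_frac_deriv a T h"
    unfolding is_frac_deriv_def using F by blast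
  then have "L2_norm_D a T \<le> L2_norm h"
    unfolding L2_norm_D_def by (intro INF_lower) simp
  also have "\<dots> \<le> L2_norm ?G"
    using h by (simp only: L2_norm_le_iff)
  finally show ?thesis .
qed

section \<open>The weak time derivative\<close>

lemma has_vector_derivative_iff_difference_quotient:
  fixes f :: "real \<Rightarrow> 'a::real_normed_vector"
  shows "(f has_vector_derivative d) (at t within S) \<longleftrightarrow>
    ((\<lambda>s. (f s - f t) /\<^sub>R (s - t)) \<longlongrightarrow> d) (at t within S)"
proof -
  have "(f has_vector_derivative d) (at t within S) \<longleftrightarrow>
      ((\<lambda>s. norm ((1 / norm (s - t)) *\<^sub>R (f s - (f t + (s - t) *\<^sub>R d)))) \<longlongrightarrow> 0) (at t within S)"
    unfolding has_vector_derivative_def has_derivative_within tendsto_norm_zero_iff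
    by (simp add: bounded_linear_scaleR_left)
  also have "\<dots> \<longleftrightarrow> ((\<lambda>s. norm ((f s - f t) /\<^sub>R (s - t) - d)) \<longlongrightarrow> 0) (at t within S)"
  proof (rule Lim_cong_within[OF refl refl refl])
    fix s assume "s \<noteq> t"
    then have "(f s - f t) /\<^sub>R (s - t) - d = (1 / (s - t)) *\<^sub>R (f s - (f t + (s - t) *\<^sub>R d))"
      by (simp add: scaleR_diff_right scaleR_add_right divide_inverse)
    then show "norm ((1 / norm (s - t)) *\<^sub>R (f s - (f t + (s - t) *\<^sub>R d))) = norm ((f s - f t) /\<^sub>R (s - t) - d)"
      by simp
  qed
  also have "\<dots> \<longleftrightarrow> ((\<lambda>s. (f s - f t) /\<^sub>R (s - t)) \<longlongrightarrow> d) (at t within S)"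
    by (simp add: tendsto_norm_zero_iff Lim_null[symmetric])
  finally show ?thesis .
qed

text \<open>
  The derivative in \<open>t\<close> may be taken under the integral against \<open>\<phi>\<close>, since the difference quotients of
  \<open>U\<close> are dominated by \<open>D\<close> through the mean value inequality. The function \<open>V t\<close> is known to be a
  derivative at almost every frequency only and need not be measurable; the limit \<open>F\<close> of difference
  quotients along a sequence is a measurable version of it.
\<close>

lemma has_fourier_time_deriv:
  fixes u :: "real \<Rightarrow> 'n::finite zfunctional" and U V :: "real \<Rightarrow> real ^ 'n \<Rightarrow> complex"
  assumes U: "\<And>s. s \<ge> 0 \<Longrightarrow> has_fourier (u s) (U s)"
    and V: "AE \<xi> in lborel. \<forall>s\<ge>0. ((\<lambda>s. U s \<xi>) has_vector_derivative V s \<xi>) (at s within {0..})"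
    and t: "t \<ge> 0"
    and D: "AE \<xi> in lborel. \<forall>s\<in>{0..t+1}. norm (V s \<xi>) \<le> D \<xi>"
    and D_int: "\<And>\<phi>. \<phi> \<in> flat_schwartz \<Longrightarrow> integrable lborel (\<lambda>\<xi>. D \<xi> * norm (\<phi> \<xi>))"
  shows "\<exists>F. (AE \<xi> in lborel. F \<xi> = V t \<xi>) \<and> has_fourier (time_deriv u t) F"
proof -
  have U_meas [measurable]: "U s \<in> borel_measurable borel" if "s \<ge> 0" for s
    using U[OF that] by (simp add: has_fourier_def)
  define q where "q s \<xi> = (U s \<xi> - U t \<xi>) /\<^sub>R (s - t)" for s \<xi>
  have q_meas: "q s \<in> borel_measurable borel" if "s \<ge> 0" for s
    unfolding q_def using U_meas[OF that] U_meas[OF t] by (intro borel_measurable_scaleR borel_measurable_diff) auto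
  have q_lim: "AE \<xi> in lborel. ((\<lambda>s. q s \<xi>) \<longlongrightarrow> V t \<xi>) (at t within {0..})"
    using V by eventually_elim (use t in \<open>simp add: q_def has_vector_derivative_iff_difference_quotient\<close>)
  have q_bound: "AE \<xi> in lborel. \<forall>s\<in>{0..t+1} - {t}. norm (q s \<xi>) \<le> D \<xi>"
    using V D
  proof eventually_elim
    fix \<xi>
    assume V: "\<forall>s\<ge>0. ((\<lambda>s. U s \<xi>) has_vector_derivative V s \<xi>) (at s within {0..})"
      and D: "\<forall>s\<in>{0..t+1}. norm (V s \<xi>) \<le> D \<xi>"
    show "\<forall>s\<in>{0..t+1} - {t}. norm (q s \<xi>) \<le> D \<xi>"
    proof
      fix s assume s: "s \<in> {0..t+1} - {t}"
      have "norm (U s \<xi> - U t \<xi>) \<le> D \<xi> * norm (s - t)"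
      proof (rule differentiable_bound)
        fix r assume r: "r \<in> {0..t+1}"
        then have "((\<lambda>s. U s \<xi>) has_vector_derivative V r \<xi>) (at r within {0..t+1})"
          using V by (auto intro: has_vector_derivative_within_subset)
        then show "((\<lambda>s. U s \<xi>) has_derivative (\<lambda>h. h *\<^sub>R V r \<xi>)) (at r within {0..t+1})"
          by (simp add: has_vector_derivative_def)
        show "onorm (\<lambda>h. h *\<^sub>R V r \<xi>) \<le> D \<xi>"
        proof (rule onorm_le)
          fix h
          have "norm (V r \<xi>) \<le> D \<xi>"
            using D r by blast
          then show "norm (h *\<^sub>R V r \<xi>) \<le> D \<xi> * norm h"
            by (simp add: mult.commute[of "D \<xi>"] mult_left_mono)
        qed
      qed (use s t in auto)
      then show "norm (q s \<xi>) \<le> D \<xi>"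
        using s by (simp add: q_def divide_simps)
    qed
  qed
  define F where "F \<xi> = lim (\<lambda>n. q (t + 1 / real (Suc n)) \<xi>)" for \<xi>
  have [measurable]: "F \<in> borel_measurable borel"
    unfolding F_def using q_meas t by (intro borel_measurable_lim_metric) simp
  have F: "AE \<xi> in lborel. F \<xi> = V t \<xi>"
    using q_lim
  proof eventually_elim
    fix \<xi> assume lim: "((\<lambda>s. q s \<xi>) \<longlongrightarrow> V t \<xi>) (at t within {0..})"
    have "filterlim (\<lambda>n. t + 1 / real (Suc n)) (at t within {0..}) sequentially"
      unfolding filterlim_at
    proof
      have "(\<lambda>n. t + 1 / real (Suc n)) \<longlonglongrightarrow> t + 0"
        by (intro tendsto_intros LIMSEQ_Suc[OF lim_1_over_n])
      then show "(\<lambda>n. t + 1 / real (Suc n)) \<longlonglongrightarrow> t"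
        by simp
      show "\<forall>\<^sub>F n in sequentially. t + 1 / real (Suc n) \<in> {0..} \<and> t + 1 / real (Suc n) \<noteq> t"
        using t by simp
    qed
    then show "F \<xi> = V t \<xi>"
      unfolding F_def by (intro limI filterlim_compose[OF lim])
  qed
  have pairing: "integrable lborel (\<lambda>\<xi>. F \<xi> * \<phi> \<xi>) \<and>
      ((\<lambda>s. u s (fourier \<phi>)) has_vector_derivative (LINT \<xi>|lborel. F \<xi> * \<phi> \<xi>)) (at t within {0..})"
    if \<phi>: "\<phi> \<in> flat_schwartz" for \<phi>
  proof
    note [measurable] = flat_schwartz_measurable[OF \<phi>]
    have "AE \<xi> in lborel. norm (F \<xi> * \<phi> \<xi>) \<le> norm (D \<xi> * norm (\<phi> \<xi>))"
      using F D
    proof eventually_elim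
      fix \<xi> assume "F \<xi> = V t \<xi>" "\<forall>s\<in>{0..t+1}. norm (V s \<xi>) \<le> D \<xi>"
      then have "norm (F \<xi>) \<le> \<bar>D \<xi>\<bar>"
        using t by force
      then show "norm (F \<xi> * \<phi> \<xi>) \<le> norm (D \<xi> * norm (\<phi> \<xi>))"
        by (simp add: norm_mult abs_mult mult_right_mono)
    qed
    then show "integrable lborel (\<lambda>\<xi>. F \<xi> * \<phi> \<xi>)"
      by (intro Bochner_Integration.integrable_bound[OF D_int[OF \<phi>]]) measurable
    have quot: "(u s (fourier \<phi>) - u t (fourier \<phi>)) /\<^sub>R (s - t) = (LINT \<xi>|lborel. q s \<xi> * \<phi> \<xi>)" if "s \<ge> 0" for s
    proof -
      have "u r (fourier \<phi>) = (LINT \<xi>|lborel. U r \<xi> * \<phi> \<xi>)" "integrable lborel (\<lambda>\<xi>. U r \<xi> * \<phi> \<xi>)" if "r \<ge> 0" for r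
        using U[OF that] \<phi> by (auto simp: has_fourier_def)
      then show ?thesis
        using that t by (simp add: q_def left_diff_distrib)
    qed
    show "((\<lambda>s. u s (fourier \<phi>)) has_vector_derivative (LINT \<xi>|lborel. F \<xi> * \<phi> \<xi>)) (at t within {0..})"
      unfolding has_vector_derivative_iff_difference_quotient tendsto_at_iff_sequentially
    proof (intro allI impI)
      fix X :: "nat \<Rightarrow> real" assume X: "\<forall>i. X i \<in> {0..} - {t}" "X \<longlonglongrightarrow> t"
      then have "\<forall>\<^sub>F i in sequentially. X i < t + 1"
        by (intro order_tendstoD(2)) auto
      then obtain N where N: "\<And>i. i \<ge> N \<Longrightarrow> X i < t + 1"
        by (auto simp: eventually_sequentially)
      have "(\<lambda>i. LINT \<xi>|lborel. q (X (i + N)) \<xi> * \<phi> \<xi>) \<longlonglongrightarrow> (LINT \<xi>|lborel. F \<xi> * \<phi> \<xi>)"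
      proof (rule integral_dominated_convergence[OF _ _ D_int[OF \<phi>]])
        show "(\<lambda>\<xi>. q (X (i + N)) \<xi> * \<phi> \<xi>) \<in> borel_measurable lborel" for i
          using q_meas[of "X (i + N)"] X(1) by simp
        show "AE \<xi> in lborel. (\<lambda>i. q (X (i + N)) \<xi> * \<phi> \<xi>) \<longlonglongrightarrow> F \<xi> * \<phi> \<xi>"
          using q_lim F
        proof eventually_elim
          fix \<xi> assume lim: "((\<lambda>s. q s \<xi>) \<longlongrightarrow> V t \<xi>) (at t within {0..})" and "F \<xi> = V t \<xi>"
          then have "(\<lambda>i. q (X i) \<xi>) \<longlonglongrightarrow> F \<xi>"
            using X by (auto simp: tendsto_at_iff_sequentially comp_def)
          then show "(\<lambda>i. q (X (i + N)) \<xi> * \<phi> \<xi>) \<longlonglongrightarrow> F \<xi> * \<phi> \<xi>"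
            by (intro tendsto_mult tendsto_const LIMSEQ_ignore_initial_segment)
        qed
        show "AE \<xi> in lborel. norm (q (X (i + N)) \<xi> * \<phi> \<xi>) \<le> D \<xi> * norm (\<phi> \<xi>)" for i
          using q_bound
        proof eventually_elim
          fix \<xi> assume "\<forall>s\<in>{0..t+1} - {t}. norm (q s \<xi>) \<le> D \<xi>"
          then show "norm (q (X (i + N)) \<xi> * \<phi> \<xi>) \<le> D \<xi> * norm (\<phi> \<xi>)"
            using X(1) N[of "i + N"] by (auto simp: norm_mult less_imp_le intro!: mult_right_mono)
        qed
      qed measurable
      then have "(\<lambda>i. (u (X (i + N)) (fourier \<phi>) - u t (fourier \<phi>)) /\<^sub>R (X (i + N) - t)) \<longlonglongrightarrow> (LINT \<xi>|lborel. F \<xi> * \<phi> \<xi>)"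
        using quot X(1) by simp
      then show "((\<lambda>s. (u s (fourier \<phi>) - u t (fourier \<phi>)) /\<^sub>R (s - t)) \<circ> X) \<longlonglongrightarrow> (LINT \<xi>|lborel. F \<xi> * \<phi> \<xi>)"
        unfolding comp_def by (rule LIMSEQ_offset)
    qed
  qed
  have "at_right t \<le> at t within {0..}"
    using t by (intro at_le) auto
  then have "at t within {0..} \<noteq> bot"
    using trivial_limit_at_right_real[of t] by (metis le_bot)
  then have "time_deriv u t (fourier \<phi>) = (LINT \<xi>|lborel. F \<xi> * \<phi> \<xi>)" if "\<phi> \<in> flat_schwartz" for \<phi>
    unfolding time_deriv_def using pairing[OF that] by (intro vector_derivative_within) auto
  then have "has_fourier (time_deriv u t) F"
    unfolding has_fourier_def using pairing by auto
  then show ?thesis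
    using F by blast
qed

section \<open>Estimates of solutions in homogeneous Sobolev norms\<close>

theorem theorem5p4:
  fixes \<beta> :: real and b g :: "real \<Rightarrow> real"
  assumes beta: "\<beta> \<ge> 2"
    and b: "b = (\<lambda>t. exp (exp t))"
    and g: "g = (\<lambda>t. 2 * exp (- t))"
  shows "\<exists>C>0. \<forall>(u0 :: 'n::finite zfunctional) u1 u. sobolev_solution b g u0 u1 u \<longrightarrow>
    (\<forall>t\<ge>0.
       L2_norm_D \<beta> (u t) \<le> ennreal C * (hdot_norm \<beta> u0 + hdot_norm (\<beta> - 2) u1) \<and>
       L2_norm_D \<beta> (time_deriv u t) \<le> ennreal C *
         (ennreal (b t) * (hdot_norm \<beta> u0 + hdot_norm (\<beta> - 2) u1)
          + ennreal (g t) * (hdot_norm (\<beta> + 2) u0 + hdot_norm \<beta> u1)))"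
  \<comment> \<open>8 is the factor 2 in front of the initial velocity times the factor 2 of each of the two applications
    of the weighted triangle inequality in the estimate of the time derivative\<close>
proof (intro exI[of _ "8::real"] conjI allI impI)
  fix u0 u1 :: "'n zfunctional" and u and t :: real
  assume sol: "sobolev_solution b g u0 u1 u" and t: "t \<ge> 0"
  define f0 where "f0 = fourier_fn u0"
  define f1 where "f1 = fourier_fn u1"
  have ex: "\<exists>F. has_fourier u0 F" "\<exists>F. has_fourier u1 F"
    using sol by (auto simp: sobolev_solution_def)
  have "has_fourier u0 f0" "has_fourier u1 f1"
    unfolding f0_def f1_def fourier_fn_def by (fact someI_ex[OF ex(1)] someI_ex[OF ex(2)])+
  then have [measurable]: "f0 \<in> borel_measurable borel" "f1 \<in> borel_measurable borel"
    by (auto simp: has_fourier_def)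
  obtain U V W where U: "\<And>s. s \<ge> 0 \<Longrightarrow> has_fourier (u s) (U s)"
    and ode: "AE \<xi> in lborel. \<forall>t\<ge>0.
           ((\<lambda>s. U s \<xi>) has_vector_derivative V t \<xi>) (at t within {0..}) \<and>
           ((\<lambda>s. V s \<xi>) has_vector_derivative W t \<xi>) (at t within {0..}) \<and>
           W t \<xi> + complex_of_real ((norm \<xi>)\<^sup>2) * U t \<xi>
             + complex_of_real (b t + g t * (norm \<xi>)\<^sup>2) * V t \<xi> = 0"
    and U0: "AE \<xi> in lborel. U 0 \<xi> = f0 \<xi>" and V0: "AE \<xi> in lborel. V 0 \<xi> = f1 \<xi>"
    using sol unfolding sobolev_solution_def f0_def f1_def by blast
  define P where "P a f \<xi> = complex_of_real (norm \<xi> powr a) * f \<xi>" for a :: real and f :: "real ^ 'n \<Rightarrow> complex" and \<xi>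
  have P_norm: "norm (P a f \<xi>) = norm \<xi> powr a * norm (f \<xi>)" for a f \<xi>
    by (simp add: P_def norm_mult)
  have [measurable]: "P a f \<in> borel_measurable borel" if "f \<in> borel_measurable borel" for a f
    unfolding P_def using that by measurable
  have hdot: "hdot_norm a u0 = L2_norm (P a f0)" "hdot_norm a u1 = L2_norm (P a f1)" for a
    using ex by (simp_all add: hdot_norm_def P_def[abs_def] f0_def f1_def)
  \<comment> \<open>the bound for a single mode in terms of the transformed data\<close>
  define M where "M \<xi> = norm (f0 \<xi>) + 2 / (norm \<xi>)\<^sup>2 * norm (f1 \<xi>)" for \<xi>
  have mode: "AE \<xi> in lborel. \<xi> \<noteq> 0 \<and> (\<forall>s\<ge>0. norm (U s \<xi>) \<le> M \<xi> \<and> norm (V s \<xi>) \<le> (b s + g s * (norm \<xi>)\<^sup>2) * M \<xi>)"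
    using ode U0 V0 AE_lborel_singleton[of 0]
  proof eventually_elim
    fix \<xi> :: "real ^ 'n"
    assume ode: "\<forall>t\<ge>0. ((\<lambda>s. U s \<xi>) has_vector_derivative V t \<xi>) (at t within {0..}) \<and>
           ((\<lambda>s. V s \<xi>) has_vector_derivative W t \<xi>) (at t within {0..}) \<and>
           W t \<xi> + complex_of_real ((norm \<xi>)\<^sup>2) * U t \<xi>
             + complex_of_real (b t + g t * (norm \<xi>)\<^sup>2) * V t \<xi> = 0"
      and init: "U 0 \<xi> = f0 \<xi>" "V 0 \<xi> = f1 \<xi>" and \<xi>: "\<xi> \<noteq> 0"
    have "norm (U s \<xi>) \<le> M \<xi>" "norm (V s \<xi>) \<le> (b s + g s * (norm \<xi>)\<^sup>2) * M \<xi>" if "s \<ge> 0" for s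
      using damped_mode_bound[of s "norm \<xi>" "\<lambda>s. U s \<xi>" "\<lambda>s. V s \<xi>" "\<lambda>s. W s \<xi>"] that \<xi> ode
      unfolding M_def b g init[symmetric] by auto
    with \<xi> show "\<xi> \<noteq> 0 \<and> (\<forall>s\<ge>0. norm (U s \<xi>) \<le> M \<xi> \<and> norm (V s \<xi>) \<le> (b s + g s * (norm \<xi>)\<^sup>2) * M \<xi>)"
      by blast
  qed
  have weight: "norm \<xi> powr a * M \<xi> = norm (P a f0 \<xi>) + 2 * norm (P (a - 2) f1 \<xi>)"
    "norm \<xi> powr a * (norm \<xi>)\<^sup>2 = norm \<xi> powr (a + 2)" if "\<xi> \<noteq> 0" for a and \<xi> :: "real ^ 'n"
    using that by (auto simp: M_def P_norm algebra_simps powr_diff powr_add powr_numeral)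
  have "L2_norm_D \<beta> (u t) \<le> 2 * (ennreal 1 * hdot_norm \<beta> u0 + ennreal 2 * hdot_norm (\<beta> - 2) u1)" (is "_ \<le> ?R")
  proof (cases "?R = top")
    case False
    have "L2_norm (P \<beta> (U t)) \<le> ?R"
      unfolding hdot
    proof (rule L2_norm_le_weighted_sum)
      show "AE \<xi> in lborel. norm (P \<beta> (U t) \<xi>) \<le> 1 * norm (P \<beta> f0 \<xi>) + 2 * norm (P (\<beta> - 2) f1 \<xi>)"
        using mode
      proof eventually_elim
        fix \<xi> assume *: "\<xi> \<noteq> 0 \<and> (\<forall>s\<ge>0. norm (U s \<xi>) \<le> M \<xi> \<and> norm (V s \<xi>) \<le> (b s + g s * (norm \<xi>)\<^sup>2) * M \<xi>)"
        then have "norm (P \<beta> (U t) \<xi>) \<le> norm \<xi> powr \<beta> * M \<xi>"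
          using t by (simp add: P_norm mult_left_mono)
        then show "norm (P \<beta> (U t) \<xi>) \<le> 1 * norm (P \<beta> f0 \<xi>) + 2 * norm (P (\<beta> - 2) f1 \<xi>)"
          using * by (simp add: weight)
      qed
    qed auto
    moreover from this False have "L2_norm (P \<beta> (U t)) < top"
      by (metis le_less_trans less_top)
    ultimately show ?thesis
      using L2_norm_D_le[OF U[OF t], of \<beta>] unfolding P_def[abs_def] by (meson order_trans)
  qed auto
  also have "\<dots> \<le> ennreal 8 * (hdot_norm \<beta> u0 + hdot_norm (\<beta> - 2) u1)"
    unfolding distrib_left mult.assoc[symmetric] by (intro add_mono mult_right_mono) auto
  finally show "L2_norm_D \<beta> (u t) \<le> ennreal 8 * (hdot_norm \<beta> u0 + hdot_norm (\<beta> - 2) u1)" .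
  show "L2_norm_D \<beta> (time_deriv u t) \<le> ennreal 8 *
         (ennreal (b t) * (hdot_norm \<beta> u0 + hdot_norm (\<beta> - 2) u1)
          + ennreal (g t) * (hdot_norm (\<beta> + 2) u0 + hdot_norm \<beta> u1))" (is "_ \<le> ?R")
  proof (cases "?R = top")
    case False
    have bg: "b s > 0" "g s > 0" for s
      by (simp_all add: b g)
    \<comment> \<open>\<open>N a\<close> is \<open>norm \<xi> powr a * M \<xi>\<close> off the origin\<close>
    define N where "N a \<xi> = complex_of_real (norm (P a f0 \<xi>) + 2 * norm (P (a - 2) f1 \<xi>))" for a \<xi>
    have [measurable]: "N a \<in> borel_measurable borel" for a
      unfolding N_def by measurable
    have N_norm: "L2_norm (N a) \<le> 4 * (hdot_norm a u0 + hdot_norm (a - 2) u1)" for a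
    proof -
      have "L2_norm (N a) \<le> 2 * (ennreal 1 * L2_norm (P a f0) + ennreal 2 * L2_norm (P (a - 2) f1))"
        by (rule L2_norm_le_weighted_sum) (auto simp: N_def simp del: of_real_add)
      also have "\<dots> \<le> 4 * (hdot_norm a u0 + hdot_norm (a - 2) u1)"
        unfolding distrib_left mult.assoc[symmetric] hdot by (intro add_mono mult_right_mono) auto
      finally show ?thesis .
    qed
    have N_eq: "norm (N a \<xi>) = norm \<xi> powr a * M \<xi>" if "\<xi> \<noteq> 0" for a \<xi>
      unfolding weight(1)[OF that] N_def norm_of_real by simp
    have N_fin: "L2_norm (N \<beta>) < top" "L2_norm (N (\<beta> + 2)) < top"
      using False N_norm[of \<beta>] N_norm[of "\<beta> + 2"] bg[of t]
      by (auto simp: less_top[symmetric] top_unique ennreal_mult_eq_top_iff)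
    \<comment> \<open>a bound for the transformed velocity that is uniform on \<open>{0..t+1}\<close>: \<open>b\<close> increases and \<open>g \<le> 2\<close>\<close>
    define D where "D \<xi> = (b (t + 1) + 2 * (norm \<xi>)\<^sup>2) * M \<xi>" for \<xi>
    have M_nonneg: "M \<xi> \<ge> 0" for \<xi>
      by (simp add: M_def)
    have [measurable]: "D \<in> borel_measurable borel"
      unfolding D_def M_def by measurable
    have "\<exists>F. (AE \<xi> in lborel. F \<xi> = V t \<xi>) \<and> has_fourier (time_deriv u t) F"
    proof (rule has_fourier_time_deriv[OF U _ t])
      show "AE \<xi> in lborel. \<forall>s\<ge>0. ((\<lambda>s. U s \<xi>) has_vector_derivative V s \<xi>) (at s within {0..})"
        using ode by eventually_elim blast
      show "AE \<xi> in lborel. \<forall>s\<in>{0..t+1}. norm (V s \<xi>) \<le> D \<xi>"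
        using mode
      proof eventually_elim
        fix \<xi> assume *: "\<xi> \<noteq> 0 \<and> (\<forall>s\<ge>0. norm (U s \<xi>) \<le> M \<xi> \<and> norm (V s \<xi>) \<le> (b s + g s * (norm \<xi>)\<^sup>2) * M \<xi>)"
        have "(b s + g s * (norm \<xi>)\<^sup>2) * M \<xi> \<le> D \<xi>" if "s \<in> {0..t+1}" for s
          unfolding D_def using that by (intro mult_right_mono add_mono M_nonneg) (auto simp: b g)
        then show "\<forall>s\<in>{0..t+1}. norm (V s \<xi>) \<le> D \<xi>"
          using * by fastforce
      qed
      fix \<phi> :: "real ^ 'n \<Rightarrow> complex" assume \<phi>: "\<phi> \<in> flat_schwartz"
      note [measurable] = flat_schwartz_measurable[OF \<phi>]
      have i: "integrable lborel (\<lambda>\<xi>. N a \<xi> * (complex_of_real (norm \<xi> powr (- \<beta>)) * \<phi> \<xi>))" if "L2_norm (N a) < top" for a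
        using that flat_schwartz_weighted_L2_sq[OF \<phi>, of \<beta>]
        by (intro integrable_pairing) (auto simp: L2_norm_finite_iff)
      show "integrable lborel (\<lambda>\<xi>. D \<xi> * norm (\<phi> \<xi>))"
      proof (rule Bochner_Integration.integrable_bound)
        show "integrable lborel (\<lambda>\<xi>. b (t + 1) * norm (N \<beta> \<xi> * (complex_of_real (norm \<xi> powr (- \<beta>)) * \<phi> \<xi>))
            + 2 * norm (N (\<beta> + 2) \<xi> * (complex_of_real (norm \<xi> powr (- \<beta>)) * \<phi> \<xi>)))"
          by (intro Bochner_Integration.integrable_add integrable_mult_right integrable_norm i N_fin)
        show "AE \<xi> in lborel. norm (D \<xi> * norm (\<phi> \<xi>)) \<le> norm (b (t + 1) * norm (N \<beta> \<xi> * (complex_of_real (norm \<xi> powr (- \<beta>)) * \<phi> \<xi>))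
            + 2 * norm (N (\<beta> + 2) \<xi> * (complex_of_real (norm \<xi> powr (- \<beta>)) * \<phi> \<xi>)))"
          using AE_lborel_singleton[of 0]
        proof eventually_elim
          fix \<xi> :: "real ^ 'n" assume \<xi>: "\<xi> \<noteq> 0"
          have w: "norm (N a \<xi> * (complex_of_real (norm \<xi> powr (- \<beta>)) * \<phi> \<xi>)) = norm \<xi> powr (a - \<beta>) * M \<xi> * norm (\<phi> \<xi>)" for a
            using \<xi> by (simp add: norm_mult norm_inverse N_eq powr_diff powr_minus divide_inverse)
          have "b (t + 1) * norm (N \<beta> \<xi> * (complex_of_real (norm \<xi> powr (- \<beta>)) * \<phi> \<xi>))
            + 2 * norm (N (\<beta> + 2) \<xi> * (complex_of_real (norm \<xi> powr (- \<beta>)) * \<phi> \<xi>)) = D \<xi> * norm (\<phi> \<xi>)"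
            unfolding w using \<xi> by (simp add: D_def powr_numeral algebra_simps)
          then show "norm (D \<xi> * norm (\<phi> \<xi>)) \<le> norm (b (t + 1) * norm (N \<beta> \<xi> * (complex_of_real (norm \<xi> powr (- \<beta>)) * \<phi> \<xi>))
            + 2 * norm (N (\<beta> + 2) \<xi> * (complex_of_real (norm \<xi> powr (- \<beta>)) * \<phi> \<xi>)))"
            by simp
        qed
      qed measurable
    qed
    then obtain F where F: "AE \<xi> in lborel. F \<xi> = V t \<xi>" and has_F: "has_fourier (time_deriv u t) F"
      by blast
    have "L2_norm (P \<beta> F) \<le> 2 * (ennreal (b t) * L2_norm (N \<beta>) + ennreal (g t) * L2_norm (N (\<beta> + 2)))"
    proof (rule L2_norm_le_weighted_sum)
      show "AE \<xi> in lborel. norm (P \<beta> F \<xi>) \<le> b t * norm (N \<beta> \<xi>) + g t * norm (N (\<beta> + 2) \<xi>)"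
        using mode F
      proof eventually_elim
        fix \<xi> assume *: "\<xi> \<noteq> 0 \<and> (\<forall>s\<ge>0. norm (U s \<xi>) \<le> M \<xi> \<and> norm (V s \<xi>) \<le> (b s + g s * (norm \<xi>)\<^sup>2) * M \<xi>)"
          and F: "F \<xi> = V t \<xi>"
        then have "norm (P \<beta> F \<xi>) \<le> norm \<xi> powr \<beta> * ((b t + g t * (norm \<xi>)\<^sup>2) * M \<xi>)"
          using t by (simp add: P_norm mult_left_mono)
        also have "\<dots> = b t * norm (N \<beta> \<xi>) + g t * norm (N (\<beta> + 2) \<xi>)"
          using * by (simp add: N_eq weight(2)[symmetric] algebra_simps)
        finally show "norm (P \<beta> F \<xi>) \<le> b t * norm (N \<beta> \<xi>) + g t * norm (N (\<beta> + 2) \<xi>)" .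
      qed
    qed (use bg in \<open>auto simp: less_imp_le\<close>)
    also have "\<dots> \<le> 2 * (ennreal (b t) * (4 * (hdot_norm \<beta> u0 + hdot_norm (\<beta> - 2) u1))
        + ennreal (g t) * (4 * (hdot_norm (\<beta> + 2) u0 + hdot_norm \<beta> u1)))"
      using N_norm[of \<beta>] N_norm[of "\<beta> + 2"] by (intro mult_left_mono add_mono) auto
    also have "\<dots> = ?R"
    proof -
      have "2 * (x * (4 * y) + z * (4 * w)) = 8 * (x * y + z * w)" for x y z w :: ennreal
        by (simp add: distrib_left mult.left_commute[of x 4] mult.left_commute[of z 4])
      then show ?thesis
        by (simp only: ennreal_numeral)
    qed
    finally have le: "L2_norm (P \<beta> F) \<le> ?R" .
    with False have "L2_norm (P \<beta> F) < top"
      by (metis le_less_trans less_top)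
    then have "L2_norm_D \<beta> (time_deriv u t) \<le> L2_norm (P \<beta> F)"
      using L2_norm_D_le[OF has_F, of \<beta>] by (simp add: P_def[abs_def])
    then show ?thesis
      using le by (rule order_trans)
  qed auto
qed auto

end
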